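(* There exist graphs $G$ and $H$ such that $G\cong_{\mathcal{DNN}}H$ but $G$ and $H$ are not quantum isomorphic.
   Context: Graphs are finite, simple and undirected, with vertex sets $V_G,V_H$ taken disjoint. For vertices $x,y$ of the same graph, $\mathrm{rel}(x,y)$ denotes their relationship: equal, adjacent, or distinct non-adjacent. $\mathcal{DNN}$ is the cone of positive semidefinite matrices with nonnegative real entries. $G\cong_{\mathcal{DNN}}H$ means: there is a matrix $M\in\mathcal{DNN}$ with rows and columns indexed by $V_G\times V_H$ such that $\sum_{h,h'\in V_H}M_{gh,g'h'}=1$ for all $g,g'\in V_G$; $\sum_{g,g'\in V_G}M_{gh,g'h'}=1$ for all $h,h'\in V_H$; and $M_{gh,g'h'}=0$ whenever $\mathrm{rel}(g,g')\neq\mathrm{rel}(h,h')$. The $(G,H)$-isomorphism game: put $V=V_G\cup V_H$. Alice and Bob receive $x_A,x_B\in V$ and respond, without communicating, with $y_A,y_B\in V$. They win if (i) $x_A\in V_G\Leftrightarrow y_A\in V_H$ and $x_B\in V_G\Leftrightarrow y_B\in V_H$, and (ii) $\mathrm{rel}(g_A,g_B)=\mathrm{rel}(h_A,h_B)$, where $g_A$ (resp. $h_A$) is the unique vertex of $G$ (resp. $H$) among $x_A,y_A$, and $g_B,h_B$ are defined similarly. A quantum strategy consists of a unit vector $\psi\in\mathbb C^d\otimes\mathbb C^d$ for some finite $d$ (of full Schmidt rank, without loss of generality) and, for each $x\in V$, families $(P_{xy})_{y\in V}$ and $(Q_{xy})_{y\in V}$ of positive semidefinite $d\times d$ matrices,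 each family summing to the identity; it yields $p(y,y'|x,x')=\psi^\dagger(P_{xy}\otimes Q_{x'y'})\psi$, and is perfect if $p(y_A,y_B|x_A,x_B)=0$ whenever (i) or (ii) fails. $G$ and $H$ are quantum isomorphic if a perfect quantum strategy exists. Equivalently (a known result), there exist projectors $P_{gh}\in\mathbb C^{d\times d}$ ($g\in V_G$, $h\in V_H$) for some $d$ with $\sum_hP_{gh}=I$ for all $g$, $\sum_gP_{gh}=I$ for all $h$, and $P_{gh}P_{g'h'}=0$ whenever $\mathrm{rel}(g,g')\ne\mathrm{rel}(h,h')$. *)

theory Defs
  imports "Graph_Theory.Pair_Digraph" "Jordan_Normal_Form.Schur_Decomposition"
begin

text \<open>
  Finite simple undirected graphs are the library's \<^locale>\<open>pair_graph\<close>: finitely many vertices,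
  and a finite symmetric loop-free set of arcs between them.
\<close>

datatype relationship = Equal | Adjacent | Distinct_Nonadjacent

definition rel :: "'a pair_pre_digraph \<Rightarrow> 'a \<Rightarrow> 'a \<Rightarrow> relationship" where
  "rel G x y =
    (if x = y then Equal
     else if (x, y) \<in> parcs G then Adjacent
     else Distinct_Nonadjacent)"


section \<open>The DNN relaxation of graph isomorphism\<close>

text \<open>Real matrices with rows and columns indexed by a finite set \<open>I\<close> are functions
  \<open>'i \<Rightarrow> 'i \<Rightarrow> real\<close>, of which only the values on \<open>I\<close> matter.\<close>

definition psd_on :: "'i set \<Rightarrow> ('i \<Rightarrow> 'i \<Rightarrow> real) \<Rightarrow> bool" where
  "psd_on I M \<longleftrightarrow>
    (\<forall>i\<in>I. \<forall>j\<in>I. M i j = M j i) \<and>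
    (\<forall>c :: 'i \<Rightarrow> real. 0 \<le> (\<Sum>i\<in>I. \<Sum>j\<in>I. c i * M i j * c j))"

definition dnn_on :: "'i set \<Rightarrow> ('i \<Rightarrow> 'i \<Rightarrow> real) \<Rightarrow> bool" where
  "dnn_on I M \<longleftrightarrow> psd_on I M \<and> (\<forall>i\<in>I. \<forall>j\<in>I. 0 \<le> M i j)"

definition dnn_isomorphic :: "'a pair_pre_digraph \<Rightarrow> 'b pair_pre_digraph \<Rightarrow> bool" where
  "dnn_isomorphic G H \<longleftrightarrow>
    (\<exists>M :: 'a \<times> 'b \<Rightarrow> 'a \<times> 'b \<Rightarrow> real.
      dnn_on (pverts G \<times> pverts H) M \<and>
      (\<forall>g\<in>pverts G. \<forall>g'\<in>pverts G. (\<Sum>h\<in>pverts H. \<Sum>h'\<in>pverts H. M (g, h) (g', h')) = 1) \<and>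
      (\<forall>h\<in>pverts H. \<forall>h'\<in>pverts H. (\<Sum>g\<in>pverts G. \<Sum>g'\<in>pverts G. M (g, h) (g', h')) = 1) \<and>
      (\<forall>g\<in>pverts G. \<forall>g'\<in>pverts G. \<forall>h\<in>pverts H. \<forall>h'\<in>pverts H.
        rel G g g' \<noteq> rel H h h' \<longrightarrow> M (g, h) (g', h') = 0))"


section \<open>The isomorphism game\<close>

text \<open>Taking the two vertex sets disjoint is rendered by the disjoint union \<open><+>\<close>: vertices of \<open>G\<close>
  are tagged by \<open>Inl\<close>, vertices of \<open>H\<close> by \<open>Inr\<close>.\<close>

definition game_verts :: "'a pair_pre_digraph \<Rightarrow> 'b pair_pre_digraph \<Rightarrow> ('a + 'b) set" where
  "game_verts G H = pverts G <+> pverts H"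

definition the_G :: "'a + 'b \<Rightarrow> 'a + 'b \<Rightarrow> 'a" where
  "the_G x y = (THE g. Inl g \<in> {x, y})"

definition the_H :: "'a + 'b \<Rightarrow> 'a + 'b \<Rightarrow> 'b" where
  "the_H x y = (THE h. Inr h \<in> {x, y})"

definition opposite_sides ::
  "'a pair_pre_digraph \<Rightarrow> 'b pair_pre_digraph \<Rightarrow> 'a + 'b \<Rightarrow> 'a + 'b \<Rightarrow> bool" where
  "opposite_sides G H x y \<longleftrightarrow> (x \<in> Inl ` pverts G \<longleftrightarrow> y \<in> Inr ` pverts H)"

text \<open>The descriptions \<^const>\<open>the_G\<close> and \<^const>\<open>the_H\<close> are meaningful only under the first two
  conjuncts; if these fail, the game is lost whatever the third one says.\<close>

definition wins :: "'a pair_pre_digraph \<Rightarrow> 'b pair_pre_digraph \<Rightarrow>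
    'a + 'b \<Rightarrow> 'a + 'b \<Rightarrow> 'a + 'b \<Rightarrow> 'a + 'b \<Rightarrow> bool" where
  "wins G H xA xB yA yB \<longleftrightarrow>
    opposite_sides G H xA yA \<and> opposite_sides G H xB yB \<and>
    rel G (the_G xA yA) (the_G xB yB) = rel H (the_H xA yA) (the_H xB yB)"


section \<open>Quantum strategies\<close>

definition psd_mat :: "nat \<Rightarrow> complex mat \<Rightarrow> bool" where
  "psd_mat d A \<longleftrightarrow>
    A \<in> carrier_mat d d \<and> mat_adjoint A = A \<and> (\<forall>v \<in> carrier_vec d. 0 \<le> (A *\<^sub>v v) \<bullet>c v)"

text \<open>Kronecker product; \<open>\<complex>\<^sup>d \<otimes> \<complex>\<^sup>d\<close> is identified with \<open>carrier_vec (d * d)\<close>, the basis vector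
  \<open>e\<^sub>i \<otimes> e\<^sub>j\<close> being the unit vector of index \<open>i * d + j\<close>.\<close>

definition kronecker :: "complex mat \<Rightarrow> complex mat \<Rightarrow> complex mat" where
  "kronecker A B = mat (dim_row A * dim_row B) (dim_col A * dim_col B)
    (\<lambda>(i, j). A $$ (i div dim_row B, j div dim_col B) * B $$ (i mod dim_row B, j mod dim_col B))"

definition measurements :: "nat \<Rightarrow> 'v set \<Rightarrow> ('v \<Rightarrow> 'v \<Rightarrow> complex mat) \<Rightarrow> bool" where
  "measurements d V P \<longleftrightarrow>
    (\<forall>x\<in>V. (\<forall>y\<in>V. psd_mat d (P x y)) \<and> mat d d (\<lambda>ij. \<Sum>y\<in>V. P x y $$ ij) = 1\<^sub>m d)"

text \<open>No full Schmidt rank is imposed on \<open>\<psi>\<close>: imposing it loses no generality, so it is not part of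
  the definition.\<close>

definition quantum_strategy :: "nat \<Rightarrow> 'v set \<Rightarrow> complex vec \<Rightarrow>
    ('v \<Rightarrow> 'v \<Rightarrow> complex mat) \<Rightarrow> ('v \<Rightarrow> 'v \<Rightarrow> complex mat) \<Rightarrow> bool" where
  "quantum_strategy d V \<psi> P Q \<longleftrightarrow>
    \<psi> \<in> carrier_vec (d * d) \<and> \<psi> \<bullet>c \<psi> = 1 \<and> measurements d V P \<and> measurements d V Q"

text \<open>\<open>correlation \<psi> P Q y y' x x'\<close> is \<open>p(y,y'|x,x') = \<psi>\<^sup>\<dagger> (P\<^sub>x\<^sub>y \<otimes> Q\<^sub>x\<^sub>'\<^sub>y\<^sub>') \<psi>\<close>; the operation \<open>\<bullet>c\<close>
  conjugates its right argument.\<close>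

definition correlation :: "complex vec \<Rightarrow> ('v \<Rightarrow> 'v \<Rightarrow> complex mat) \<Rightarrow> ('v \<Rightarrow> 'v \<Rightarrow> complex mat) \<Rightarrow>
    'v \<Rightarrow> 'v \<Rightarrow> 'v \<Rightarrow> 'v \<Rightarrow> complex" where
  "correlation \<psi> P Q y y' x x' = (kronecker (P x y) (Q x' y') *\<^sub>v \<psi>) \<bullet>c \<psi>"

definition quantum_isomorphic :: "'a pair_pre_digraph \<Rightarrow> 'b pair_pre_digraph \<Rightarrow> bool" where
  "quantum_isomorphic G H \<longleftrightarrow>
    (\<exists>d \<psi> P Q. quantum_strategy d (game_verts G H) \<psi> P Q \<and>
      (\<forall>xA \<in> game_verts G H. \<forall>xB \<in> game_verts G H.
       \<forall>yA \<in> game_verts G H. \<forall>yB \<in> game_verts G H.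
        \<not> wins G H xA xB yA yB \<longrightarrow> correlation \<psi> P Q yA yB xA xB = 0))"

end

theory Submission
  imports Defs "HOL-Library.Function_Algebras"
begin

text \<open>
  The graphs are the 4 by 4 rook graph and the Shrikhande graph. Both are strongly regular with
  parameters (16, 6, 2, 2), so their adjacency matrices have the same spectral projections up to
  the correspondence \<open>A \<mapsto> A'\<close>; the Choi matrix of this correspondence, composed with the
  projection onto the span of \<open>I, A, J\<close>, is the required DNN matrix.

  The rook graph contains a \<open>K\<^sub>4\<close>, the Shrikhande graph does not. A perfect quantum strategy
  yields operators \<open>U\<^sub>g\<^sub>h\<close> that act on the shared state \<open>\<psi>\<close> like a magic unitary intertwining the two
  adjacency matrices. If \<open>a, b, c\<close> is a triangle of the first graph, then the sum of
  \<open>\<langle>\<psi>, U\<^sub>a\<^sub>i U\<^sub>b\<^sub>j U\<^sub>c\<^sub>k \<psi>\<rangle>\<close> over all \<open>h\<close> and all neighbours \<open>i, j, k\<close> of \<open>h\<close> is the number of common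
  neighbours of \<open>a, b, c\<close>; on the other hand, as the state is tracial, a term can be nonzero
  only if \<open>i, j, k\<close> is a triangle, that is, if \<open>h, i, j, k\<close> is a \<open>K\<^sub>4\<close>.
\<close>

section \<open>Strongly regular graphs with parameters (16, 6, 2, 2)\<close>

definition idempotent_on :: "'i set \<Rightarrow> ('i \<Rightarrow> 'i \<Rightarrow> real) \<Rightarrow> bool" where
  "idempotent_on I E \<longleftrightarrow>
    (\<forall>i\<in>I. \<forall>j\<in>I. E i j = E j i \<and> (\<Sum>k\<in>I. E i k * E k j) = E i j)"

lemma idempotent_on_sym: "idempotent_on I E \<Longrightarrow> i \<in> I \<Longrightarrow> j \<in> I \<Longrightarrow> E i j = E j i"
  unfolding idempotent_on_def by blast

lemma idempotent_on_square:
  "idempotent_on I E \<Longrightarrow> i \<in> I \<Longrightarrow> j \<in> I \<Longrightarrow> (\<Sum>k\<in>I. E i k * E k j) = E i j"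
  unfolding idempotent_on_def by blast

text \<open>By symmetry \<open>E\<close> equals its transpose times \<open>E\<close>, so the
  quadratic form at \<open>c\<close> is the squared norm of \<open>E c\<close>.\<close>

lemma psd_on_idempotent:
  assumes "finite I" "idempotent_on I E"
  shows "psd_on I E"
  unfolding psd_on_def
proof (intro conjI allI)
  show "\<forall>i\<in>I. \<forall>j\<in>I. E i j = E j i"
    using idempotent_on_sym[OF assms(2)] by blast
next
  fix c :: "'a \<Rightarrow> real"
  have "(\<Sum>i\<in>I. \<Sum>j\<in>I. c i * E i j * c j) = (\<Sum>i\<in>I. \<Sum>j\<in>I. \<Sum>k\<in>I. (E k i * c i) * (E k j * c j))"
  proof (intro sum.cong refl)
    fix i j assume ij: "i \<in> I" "j \<in> I"
    have "E i j = (\<Sum>k\<in>I. E i k * E k j)"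
      by (rule idempotent_on_square[OF assms(2) ij, symmetric])
    also have "\<dots> = (\<Sum>k\<in>I. E k i * E k j)"
      using idempotent_on_sym[OF assms(2) ij(1)] by (intro sum.cong) simp_all
    finally have "E i j = (\<Sum>k\<in>I. E k i * E k j)" .
    then have "c i * E i j * c j = c i * (\<Sum>k\<in>I. E k i * E k j) * c j"
      by simp
    also have "\<dots> = (\<Sum>k\<in>I. (E k i * c i) * (E k j * c j))"
      by (simp add: sum_distrib_left sum_distrib_right mult_ac)
    finally show "c i * E i j * c j = (\<Sum>k\<in>I. (E k i * c i) * (E k j * c j))" .
  qed
  also have "\<dots> = (\<Sum>i\<in>I. \<Sum>k\<in>I. \<Sum>j\<in>I. (E k i * c i) * (E k j * c j))"
    by (intro sum.cong refl sum.swap)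
  also have "\<dots> = (\<Sum>k\<in>I. \<Sum>i\<in>I. \<Sum>j\<in>I. (E k i * c i) * (E k j * c j))"
    by (rule sum.swap)
  also have "\<dots> = (\<Sum>k\<in>I. (\<Sum>i\<in>I. E k i * c i)\<^sup>2)"
    by (simp add: power2_eq_square sum_product)
  finally show "0 \<le> (\<Sum>i\<in>I. \<Sum>j\<in>I. c i * E i j * c j)"
    by (simp add: sum_nonneg)
qed

lemma psd_on_add: "psd_on I M \<Longrightarrow> psd_on I N \<Longrightarrow> psd_on I (\<lambda>i j. M i j + N i j)"
  by (auto simp: psd_on_def algebra_simps sum.distrib intro!: add_nonneg_nonneg)

lemma psd_on_scale:
  assumes "psd_on I M" "0 \<le> r"
  shows "psd_on I (\<lambda>i j. r * M i j)"
proof -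
  have "(\<Sum>i\<in>I. \<Sum>j\<in>I. c i * (r * M i j) * c j) = r * (\<Sum>i\<in>I. \<Sum>j\<in>I. c i * M i j * c j)" for c
    by (simp add: sum_distrib_left mult_ac)
  with assms show ?thesis by (simp add: psd_on_def)
qed

lemma psd_on_cong:
  assumes "psd_on I M" "\<And>i j. i \<in> I \<Longrightarrow> j \<in> I \<Longrightarrow> M i j = N i j"
  shows "psd_on I N"
proof -
  have "(\<Sum>i\<in>I. \<Sum>j\<in>I. c i * N i j * c j) = (\<Sum>i\<in>I. \<Sum>j\<in>I. c i * M i j * c j)" for c
    by (intro sum.cong) (auto simp: assms(2))
  moreover have "N i j = N j i" if "i \<in> I" "j \<in> I" for i j
    using assms that by (metis psd_on_def)
  ultimately show ?thesis
    using assms(1) unfolding psd_on_def by metis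
qed

text \<open>The reason for working with projections: idempotence passes to tensor products by
  splitting one double sum, which yields positivity of the tensor kernel without any
  factorization.\<close>

lemma idempotent_on_tensor:
  assumes E: "idempotent_on I E" and F: "idempotent_on J F"
  shows "idempotent_on (I \<times> J) (\<lambda>x y. E (fst x) (fst y) * F (snd x) (snd y))"
  unfolding idempotent_on_def
proof (intro ballI conjI)
  fix x y assume "x \<in> I \<times> J" "y \<in> I \<times> J"
  then have x: "fst x \<in> I" "snd x \<in> J" and y: "fst y \<in> I" "snd y \<in> J"
    by auto
  show "E (fst x) (fst y) * F (snd x) (snd y) = E (fst y) (fst x) * F (snd y) (snd x)"
    by (simp only: idempotent_on_sym[OF E x(1) y(1)] idempotent_on_sym[OF F x(2) y(2)])
  have "(\<Sum>k\<in>I\<times>J. E (fst x) (fst k) * F (snd x) (snd k) * (E (fst k) (fst y) * F (snd k) (snd y)))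
      = (\<Sum>(k, l)\<in>I\<times>J. (E (fst x) k * E k (fst y)) * (F (snd x) l * F l (snd y)))"
    by (intro sum.cong) auto
  also have "\<dots> = (\<Sum>k\<in>I. E (fst x) k * E k (fst y)) * (\<Sum>l\<in>J. F (snd x) l * F l (snd y))"
    by (simp only: sum.cartesian_product[symmetric] sum_product)
  also have "\<dots> = E (fst x) (fst y) * F (snd x) (snd y)"
    by (simp only: idempotent_on_square[OF E x(1) y(1)] idempotent_on_square[OF F x(2) y(2)])
  finally show "(\<Sum>k\<in>I\<times>J. E (fst x) (fst k) * F (snd x) (snd k) * (E (fst k) (fst y) * F (snd k) (snd y)))
      = E (fst x) (fst y) * F (snd x) (snd y)" .
qed

section \<open>Adjacency matrices of the graphs and the algebra they generate\<close>

definition adj :: "'a pair_pre_digraph \<Rightarrow> 'a \<Rightarrow> 'a \<Rightarrow> real" where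
  "adj G x y = of_bool ((x, y) \<in> parcs G)"

text \<open>Adjacent and non-adjacent pairs both have 2 common neighbours, so the square of the
  adjacency matrix is 4 I + 2 J. The degree 6 is its diagonal entry.\<close>

definition srg16 :: "'a pair_pre_digraph \<Rightarrow> bool" where
  "srg16 G \<longleftrightarrow> pair_graph G \<and> card (pverts G) = 16 \<and>
    (\<forall>x\<in>pverts G. \<forall>y\<in>pverts G.
      (\<Sum>z\<in>pverts G. adj G x z * adj G z y) = (if x = y then 6 else 2))"

lemma pair_graph_sym:
  assumes "pair_graph G"
  shows "(x, y) \<in> parcs G \<longleftrightarrow> (y, x) \<in> parcs G"
proof -
  interpret pair_graph G by fact
  have "sym (parcs G)"
    using pair_sym_arcs by (simp add: symmetric_def)
  then show ?thesis by (meson symD)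
qed

lemma pair_graph_irrefl:
  assumes "pair_graph G"
  shows "(x, x) \<notin> parcs G"
proof -
  interpret pair_graph G by fact
  show ?thesis using pair_no_loops by fastforce
qed

lemma pair_graph_finite:
  assumes "pair_graph G"
  shows "finite (pverts G)"
proof -
  interpret pair_graph G by fact
  show ?thesis by (rule pair_finite_verts)
qed

context
  fixes G :: "'a pair_pre_digraph"
  assumes srg: "srg16 G"
begin

lemma srg16_pair_graph: "pair_graph G"
  using srg by (simp add: srg16_def)

lemma srg16_finite: "finite (pverts G)"
  by (rule pair_graph_finite[OF srg16_pair_graph])

lemma srg16_card: "card (pverts G) = 16"
  using srg by (simp add: srg16_def)

lemma adj_commute: "adj G x y = adj G y x"
  using pair_graph_sym[OF srg16_pair_graph] by (auto simp: adj_def)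

lemma srg16_square:
  "x \<in> pverts G \<Longrightarrow> y \<in> pverts G \<Longrightarrow>
    (\<Sum>z\<in>pverts G. adj G x z * adj G z y) = 4 * of_bool (x = y) + 2"
  using srg by (simp add: srg16_def)

text \<open>Entries are 0 or 1 and so equal their squares; a row sum is therefore a diagonal entry
  of the squared matrix.\<close>

lemma srg16_degree:
  assumes "x \<in> pverts G"
  shows "(\<Sum>z\<in>pverts G. adj G x z) = 6" "(\<Sum>z\<in>pverts G. adj G z x) = 6"
proof -
  have "(\<Sum>z\<in>pverts G. adj G x z) = (\<Sum>z\<in>pverts G. adj G x z * adj G z x)"
    by (intro sum.cong refl) (simp add: adj_commute[of _ x], simp add: adj_def)
  then show "(\<Sum>z\<in>pverts G. adj G x z) = 6"
    using srg16_square[OF assms assms] by simp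
  then show "(\<Sum>z\<in>pverts G. adj G z x) = 6"
    by (simp add: adj_commute[of _ x])
qed

lemma srg16_delta_sum:
  "x \<in> pverts G \<Longrightarrow> (\<Sum>z\<in>pverts G. of_bool (x = z) * f z) = (f x :: real)"
  "x \<in> pverts G \<Longrightarrow> (\<Sum>z\<in>pverts G. of_bool (z = x) * f z) = (f x :: real)"
  using srg16_finite by (simp_all add: of_bool_def if_distrib[of "\<lambda>t. t * _"] cong: if_cong)

text \<open>The eigenvalues 6, 2 and -2 of the adjacency matrix have multiplicities 1, 6 and 9; these
  are the orthogonal projections onto the eigenspaces of 2 and -2.\<close>

definition proj_pos :: "'a \<Rightarrow> 'a \<Rightarrow> real" where
  "proj_pos x y = of_bool (x = y) / 2 + adj G x y / 4 - 1 / 8"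

definition proj_neg :: "'a \<Rightarrow> 'a \<Rightarrow> real" where
  "proj_neg x y = of_bool (x = y) / 2 - adj G x y / 4 + 1 / 16"

text \<open>From A A = 4 I + 2 J, A J = J A = 6 J and J J = 16 J, the hypotheses compare the
  coefficients of I, A and J in the square of p I + q A + r J with p, q and r.\<close>

lemma idempotent_on_combination:
  assumes p: "p = p * p + 4 * q * q" and q: "q = 2 * p * q"
    and r: "r = 2 * p * r + 2 * q * q + 12 * q * r + 16 * r * r"
  shows "idempotent_on (pverts G) (\<lambda>x y. p * of_bool (x = y) + q * adj G x y + r)"
  unfolding idempotent_on_def
proof (intro ballI conjI)
  fix x y assume xy: "x \<in> pverts G" "y \<in> pverts G"
  show "p * of_bool (x = y) + q * adj G x y + r = p * of_bool (y = x) + q * adj G y x + r"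
    by (simp add: adj_commute[of x y] eq_commute)
  \<comment> \<open>The product is grouped so that each Kronecker delta is a single factor which
    \<open>srg16_delta_sum\<close> can collapse.\<close>
  have *: "(p * of_bool (x = z) + q * adj G x z + r) * (p * of_bool (z = y) + q * adj G z y + r) =
      p * (of_bool (x = z) * (p * of_bool (z = y) + q * adj G z y + r)) +
      p * (of_bool (z = y) * (q * adj G x z + r)) +
      q * q * (adj G x z * adj G z y) + q * r * adj G x z + q * r * adj G z y + r * r" for z
    by (simp add: algebra_simps)
  have "(\<Sum>z\<in>pverts G. (p * of_bool (x = z) + q * adj G x z + r) * (p * of_bool (z = y) + q * adj G z y + r))
      = p * (p * of_bool (x = y) + q * adj G x y + r) + p * (q * adj G x y + r) +
        q * q * (4 * of_bool (x = y) + 2) + q * r * 6 + q * r * 6 + 16 * (r * r)"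
    unfolding *
    by (simp add: sum.distrib sum_distrib_left[symmetric] srg16_delta_sum xy srg16_square
        srg16_degree srg16_card)
  also have "\<dots> = (p * p + 4 * q * q) * of_bool (x = y) + (2 * p * q) * adj G x y +
      (2 * p * r + 2 * q * q + 12 * q * r + 16 * r * r)"
    by (simp add: algebra_simps)
  finally show "(\<Sum>z\<in>pverts G. (p * of_bool (x = z) + q * adj G x z + r) * (p * of_bool (z = y) + q * adj G z y + r))
      = p * of_bool (x = y) + q * adj G x y + r"
    using p q r by simp
qed

lemma idempotent_on_projections:
  "idempotent_on (pverts G) proj_pos"
  "idempotent_on (pverts G) proj_neg"
  "idempotent_on (pverts G) (\<lambda>_ _. 1 / 16)"
  using idempotent_on_combination[of "1/2" "1/4" "- 1/8"]
    idempotent_on_combination[of "1/2" "- 1/4" "1/16"] idempotent_on_combination[of 0 0 "1/16"]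
  by (simp_all add: proj_pos_def[abs_def] proj_neg_def[abs_def])

text \<open>Sizes of two of the three relationship classes; the other 256 - 16 - 96 = 144 ordered
  pairs are distinct and non-adjacent.\<close>

lemma srg16_pair_sums:
  "(\<Sum>x\<in>pverts G. \<Sum>y\<in>pverts G. of_bool (x = y)) = (16 :: real)"
  "(\<Sum>x\<in>pverts G. \<Sum>y\<in>pverts G. adj G x y) = 96"
  using srg16_finite by (simp_all add: srg16_degree srg16_card of_bool_def)

lemma rel_eq_iff:
  "of_bool (rel G x y = Equal) = (of_bool (x = y) :: real)"
  "of_bool (rel G x y = Adjacent) = adj G x y"
  "of_bool (rel G x y = Distinct_Nonadjacent) = 1 - of_bool (x = y) - adj G x y"
  using pair_graph_irrefl[OF srg16_pair_graph] by (auto simp: rel_def adj_def)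

end

text \<open>Writing \<open>A\<^sub>R\<close> for the 0-1 matrix of a relationship \<open>R\<close>, the witness is the sum over \<open>R\<close> of
  \<open>A\<^sub>R \<otimes> A\<^sub>R / |R|\<close>, which equals the sum over the common eigenspaces of \<open>E \<otimes> E / tr E\<close>.\<close>

lemma srg16_dnn_isomorphic:
  fixes G :: "'a pair_pre_digraph" and H :: "'b pair_pre_digraph"
  assumes G: "srg16 G" and H: "srg16 H"
  shows "dnn_isomorphic G H"
proof -
  define w :: "relationship \<Rightarrow> real" where
    "w r = (case r of Equal \<Rightarrow> 1/16 | Adjacent \<Rightarrow> 1/96 | Distinct_Nonadjacent \<Rightarrow> 1/144)" for r
  define M :: "'a \<times> 'b \<Rightarrow> 'a \<times> 'b \<Rightarrow> real" where
    "M x y = (if rel G (fst x) (fst y) = rel H (snd x) (snd y) then w (rel G (fst x) (fst y)) else 0)"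
    for x y
  have M_rel: "M (g, h) (g', h') =
      of_bool (rel G g g' = Equal) * of_bool (rel H h h' = Equal) / 16 +
      of_bool (rel G g g' = Adjacent) * of_bool (rel H h h' = Adjacent) / 96 +
      of_bool (rel G g g' = Distinct_Nonadjacent) * of_bool (rel H h h' = Distinct_Nonadjacent) / 144"
    for g h g' h'
    by (cases "rel G g g'"; cases "rel H h h'") (simp_all add: M_def w_def)
  note M_adj = M_rel[unfolded rel_eq_iff[OF G] rel_eq_iff[OF H]]
  let ?I = "pverts G \<times> pverts H"
  let ?T = "\<lambda>E F x y. E (fst x) (fst y) * F (snd x) (snd y) :: real"
  have fin: "finite ?I" using srg16_finite[OF G] srg16_finite[OF H] by simp
  note psdT = psd_on_idempotent[OF fin idempotent_on_tensor]
  \<comment> \<open>The denominators 1, 6 and 9 are the ranks of the three projections. The factor 1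
    gives all summands the shape required by \<open>psd_on_scale\<close>.\<close>
  have "psd_on ?I (\<lambda>x y. 1 * ?T (\<lambda>_ _. 1/16) (\<lambda>_ _. 1/16) x y +
      (1/6 * ?T (proj_pos G) (proj_pos H) x y + 1/9 * ?T (proj_neg G) (proj_neg H) x y))"
    by (intro psd_on_add psd_on_scale psdT idempotent_on_projections G H) simp_all
  then have "psd_on ?I M"
  proof (rule psd_on_cong)
    fix x y assume "x \<in> ?I" "y \<in> ?I"
    obtain g h g' h' where "x = (g, h)" "y = (g', h')" by fastforce
    then show "1 * ?T (\<lambda>_ _. 1/16) (\<lambda>_ _. 1/16) x y +
      (1/6 * ?T (proj_pos G) (proj_pos H) x y + 1/9 * ?T (proj_neg G) (proj_neg H) x y) = M x y"
      by (simp add: M_adj proj_pos_def[OF G] proj_neg_def[OF G] proj_pos_def[OF H] proj_neg_def[OF H]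
          field_simps)
  qed
  moreover have "0 \<le> M x y" for x y
    by (simp add: M_def w_def split: relationship.split)
  moreover have "(\<Sum>h\<in>pverts H. \<Sum>h'\<in>pverts H. M (g, h) (g', h')) = 1" for g g'
  proof -
    \<comment> \<open>Summing the indicator of a class of \<open>H\<close> gives its size, which
      cancels the weight; of the three remaining indicators exactly one is 1.\<close>
    have "(\<Sum>h\<in>pverts H. \<Sum>h'\<in>pverts H. M (g, h) (g', h')) =
        of_bool (rel G g g' = Equal) + of_bool (rel G g g' = Adjacent) +
        of_bool (rel G g g' = Distinct_Nonadjacent)"
      unfolding M_rel rel_eq_iff[OF H]
      by (simp add: sum.distrib sum_subtractf sum_distrib_left[symmetric] sum_divide_distrib[symmetric]
          srg16_pair_sums[OF H] srg16_card[OF H])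
    then show ?thesis by (cases "rel G g g'") simp_all
  qed
  moreover have "(\<Sum>g\<in>pverts G. \<Sum>g'\<in>pverts G. M (g, h) (g', h')) = 1" for h h'
  proof -
    have "(\<Sum>g\<in>pverts G. \<Sum>g'\<in>pverts G. M (g, h) (g', h')) =
        of_bool (rel H h h' = Equal) + of_bool (rel H h h' = Adjacent) +
        of_bool (rel H h h' = Distinct_Nonadjacent)"
      unfolding M_rel rel_eq_iff[OF G]
      by (simp add: sum.distrib sum_subtractf sum_distrib_right[symmetric] sum_divide_distrib[symmetric]
          srg16_pair_sums[OF G] srg16_card[OF G])
    then show ?thesis by (cases "rel H h h'") simp_all
  qed
  moreover have "rel G g g' \<noteq> rel H h h' \<Longrightarrow> M (g, h) (g', h') = 0" for g g' h h'
    by (simp add: M_def)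
  ultimately show ?thesis
    unfolding dnn_isomorphic_def dnn_on_def by blast
qed

section \<open>Four-cliques and commuting operator strategies\<close>

text \<open>In a \<open>pair_graph\<close>, which has no loops, the six arcs force the four vertices
  to be distinct.\<close>

definition has_K4 :: "'a pair_pre_digraph \<Rightarrow> bool" where
  "has_K4 G \<longleftrightarrow> (\<exists>a\<in>pverts G. \<exists>b\<in>pverts G. \<exists>c\<in>pverts G. \<exists>e\<in>pverts G.
    (a, b) \<in> parcs G \<and> (a, c) \<in> parcs G \<and> (a, e) \<in> parcs G \<and>
    (b, c) \<in> parcs G \<and> (b, e) \<in> parcs G \<and> (c, e) \<in> parcs G)"

section \<open>Winning and losing answers\<close>

lemma rel_Equal_iff: "rel G x y = Equal \<longleftrightarrow> x = y"
  by (simp add: rel_def)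

lemma rel_refl [simp]: "rel G x x = Equal"
  by (simp add: rel_def)

lemma the_vertex_simps [simp]:
  "the_G (Inl g) (Inr h) = g" "the_G (Inr h) (Inl g) = g"
  "the_H (Inl g) (Inr h) = h" "the_H (Inr h) (Inl g) = h"
  by (simp_all add: the_G_def the_H_def)

lemma opposite_sides_simps [simp]:
  "g \<in> pverts G \<Longrightarrow> h \<in> pverts H \<Longrightarrow> opposite_sides G H (Inl g) (Inr h)"
  "opposite_sides G H (Inr h) (Inl g)"
  "g \<in> pverts G \<Longrightarrow> \<not> opposite_sides G H (Inl g) (Inl g')"
  "h \<in> pverts H \<Longrightarrow> \<not> opposite_sides G H (Inr h') (Inr h)"
  by (auto simp: opposite_sides_def)

text \<open>If both answers lie on the correct side, the two players hold the same vertex of one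
  graph but different vertices of the other.\<close>

lemma not_wins_same_question:
  assumes "x \<in> game_verts G H" "y \<in> game_verts G H" "y' \<in> game_verts G H" "y \<noteq> y'"
  shows "\<not> wins G H x x y y'"
  using assms unfolding game_verts_def
  by (elim PlusE) (auto simp: wins_def rel_Equal_iff dest: sym)

text \<open>Vectors form a mere additive group, so spaces of functions qualify, and the operators
  may be any POVM elements, not only projections. Perfection is stated as vanishing of a vector;
  \<open>kronecker_zero\<close> derives this from vanishing probabilities.\<close>

locale perfect_commuting_strategy =
  fixes G :: "'a pair_pre_digraph" and H :: "'b pair_pre_digraph"
    and A B :: "'a + 'b \<Rightarrow> 'a + 'b \<Rightarrow> 'v::ab_group_add \<Rightarrow> 'v"
    and ip :: "'v \<Rightarrow> 'v \<Rightarrow> complex" and \<psi> :: 'v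
  assumes graph_G: "pair_graph G" and graph_H: "pair_graph H"
    and A_add: "A x y (v + w) = A x y v + A x y w"
    and B_add: "B x y (v + w) = B x y v + B x y w"
    and commute: "A x y (B x' y' v) = B x' y' (A x y v)"
    and ip_add: "ip u (v + w) = ip u v + ip u w"
    and A_adjoint: "x \<in> game_verts G H \<Longrightarrow> y \<in> game_verts G H \<Longrightarrow> ip (A x y v) w = ip v (A x y w)"
    and B_adjoint: "x \<in> game_verts G H \<Longrightarrow> y \<in> game_verts G H \<Longrightarrow> ip (B x y v) w = ip v (B x y w)"
    and A_total: "x \<in> game_verts G H \<Longrightarrow> (\<Sum>y\<in>game_verts G H. A x y \<psi>) = \<psi>"
    and B_total: "x \<in> game_verts G H \<Longrightarrow> (\<Sum>y\<in>game_verts G H. B x y \<psi>) = \<psi>"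
    and ip_state: "ip \<psi> \<psi> \<noteq> 0"
    and perfect: "\<lbrakk>x \<in> game_verts G H; x' \<in> game_verts G H; y \<in> game_verts G H; y' \<in> game_verts G H;
      \<not> wins G H x x' y y'\<rbrakk> \<Longrightarrow> A x y (B x' y' \<psi>) = 0"
begin

abbreviation V :: "('a + 'b) set" where "V \<equiv> game_verts G H"

section \<open>Relations satisfied by the operators on the shared state\<close>

lemma zero: "A x y 0 = 0" "B x y 0 = 0" "ip u 0 = 0"
  using A_add[of x y 0 0] B_add[of x y 0 0] ip_add[of u 0 0] by simp_all

lemma A_sum: "A x y (sum f S) = (\<Sum>s\<in>S. A x y (f s))"
  by (induction S rule: infinite_finite_induct) (simp_all add: A_add zero)

lemma B_sum: "B x y (sum f S) = (\<Sum>s\<in>S. B x y (f s))"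
  by (induction S rule: infinite_finite_induct) (simp_all add: B_add zero)

lemma ip_sum: "ip u (sum f S) = (\<Sum>s\<in>S. ip u (f s))"
  by (induction S rule: infinite_finite_induct) (simp_all add: ip_add zero)

lemma finite_pverts: "finite (pverts G)" "finite (pverts H)"
  using graph_G graph_H by (auto intro: pair_graph_finite)

lemma finite_V: "finite V"
  using finite_pverts by (simp add: game_verts_def)

lemma in_V [simp]:
  "g \<in> pverts G \<Longrightarrow> Inl g \<in> V" "h \<in> pverts H \<Longrightarrow> Inr h \<in> V"
  by (auto simp: game_verts_def)

lemma sum_single:
  assumes "finite S" "s \<in> S" "\<And>t. t \<in> S \<Longrightarrow> t \<noteq> s \<Longrightarrow> f t = 0"
  shows "sum f S = (f s :: 'v)"
proof -
  have "sum f S = sum f {s}"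
    using assms by (intro sum.mono_neutral_right) auto
  then show ?thesis by simp
qed

text \<open>Equal questions force equal answers, so inserting the full measurement of either player
  leaves only \<open>A x y (B x y \<psi>)\<close>. This is what lets an operator next to the state
  change hands.\<close>

lemma A_eq_B:
  assumes "x \<in> V" "y \<in> V"
  shows "A x y \<psi> = B x y \<psi>"
proof -
  have "A x y \<psi> = A x y (\<Sum>y'\<in>V. B x y' \<psi>)"
    using assms by (simp add: B_total)
  also have "\<dots> = A x y (B x y \<psi>)"
    unfolding A_sum using assms
    by (intro sum_single finite_V perfect not_wins_same_question) auto
  also have "\<dots> = (\<Sum>y'\<in>V. A x y' (B x y \<psi>))"
    using assms
    by (intro sum_single[symmetric] finite_V perfect not_wins_same_question) auto
  also have "\<dots> = B x y (\<Sum>y'\<in>V. A x y' \<psi>)"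
    by (simp add: B_sum commute)
  also have "\<dots> = B x y \<psi>"
    using assms by (simp add: A_total)
  finally show ?thesis .
qed

text \<open>Such an answer loses whatever Bob replies, so every term vanishes once Bob's full
  measurement is inserted.\<close>

lemma A_wrong_side:
  assumes "x \<in> V" "y \<in> V" "\<not> opposite_sides G H x y"
  shows "A x y \<psi> = 0"
proof -
  have "A x y \<psi> = A x y (\<Sum>y'\<in>V. B x y' \<psi>)"
    using assms by (simp add: B_total)
  also have "\<dots> = 0"
    unfolding A_sum using assms
    by (intro sum.neutral ballI perfect) (auto simp: wins_def)
  finally show ?thesis .
qed

text \<open>Entries of the would-be magic unitary. Its relations are established only on
  \<open>\<psi>\<close> and on words in \<open>U\<close> applied to \<open>\<psi>\<close>.\<close>

definition U :: "'a \<Rightarrow> 'b \<Rightarrow> 'v \<Rightarrow> 'v" where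
  "U g h = A (Inl g) (Inr h)"

lemma sum_V: "sum f V = (\<Sum>g\<in>pverts G. f (Inl g)) + (\<Sum>h\<in>pverts H. f (Inr h))"
  unfolding game_verts_def using finite_pverts by (simp add: sum.Plus o_def)

lemma U_row:
  assumes "g \<in> pverts G"
  shows "(\<Sum>h\<in>pverts H. U g h \<psi>) = \<psi>"
  using A_total[of "Inl g"] assms by (simp add: sum_V A_wrong_side U_def)

lemma A_row:
  assumes "h \<in> pverts H"
  shows "(\<Sum>g\<in>pverts G. A (Inr h) (Inl g) \<psi>) = \<psi>"
  using A_total[of "Inr h"] assms by (simp add: sum_V A_wrong_side)

text \<open>Let Alice be asked \<open>g\<close> and Bob \<open>h\<close>: Alice answers
  \<open>h\<close> exactly when Bob answers \<open>g\<close>. Both resolutions of the state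
  therefore reduce to the same term. This turns rows of the measurements for \<open>H\<close> into
  columns of \<open>U\<close>.\<close>

lemma U_flip:
  assumes g: "g \<in> pverts G" and h: "h \<in> pverts H"
  shows "U g h \<psi> = A (Inr h) (Inl g) \<psi>"
proof -
  have B_row: "(\<Sum>g'\<in>pverts G. B (Inr h) (Inl g') \<psi>) = \<psi>"
    using A_row[OF h] h by (simp add: A_eq_B)
  have "U g h \<psi> = (\<Sum>g'\<in>pverts G. U g h (B (Inr h) (Inl g') \<psi>))"
    using B_row by (metis A_sum U_def)
  also have "\<dots> = U g h (B (Inr h) (Inl g) \<psi>)"
    unfolding U_def using g h
    by (intro sum_single finite_pverts perfect) (auto simp: wins_def rel_Equal_iff dest: sym)
  also have "\<dots> = (\<Sum>h'\<in>pverts H. U g h' (B (Inr h) (Inl g) \<psi>))"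
    unfolding U_def using g h
    by (intro sum_single[symmetric] finite_pverts perfect) (auto simp: wins_def rel_Equal_iff dest: sym)
  also have "\<dots> = B (Inr h) (Inl g) (\<Sum>h'\<in>pverts H. U g h' \<psi>)"
    by (simp add: B_sum commute U_def)
  also have "\<dots> = A (Inr h) (Inl g) \<psi>"
    using g h by (simp add: U_row A_eq_B)
  finally show ?thesis .
qed

lemma U_column:
  assumes "h \<in> pverts H"
  shows "(\<Sum>g\<in>pverts G. U g h \<psi>) = \<psi>"
  using A_row[OF assms] assms by (simp add: U_flip)

lemma U_state: "g \<in> pverts G \<Longrightarrow> h \<in> pverts H \<Longrightarrow> U g h \<psi> = B (Inl g) (Inr h) \<psi>"
  by (simp add: U_def A_eq_B)

lemma U_B: "U g h (B x y v) = B x y (U g h v)"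
  by (simp add: U_def commute)

lemma U_sum: "U g h (sum f S) = (\<Sum>s\<in>S. U g h (f s))"
  by (simp add: U_def A_sum)

lemma U_orthogonal:
  assumes "g \<in> pverts G" "g' \<in> pverts G" "h \<in> pverts H" "h' \<in> pverts H"
    and "rel G g g' \<noteq> rel H h h'"
  shows "U g h (U g' h' \<psi>) = 0"
  using assms by (simp add: U_state, simp add: U_def perfect wins_def)

text \<open>The last letter is replaced by Bob's operator, which commutes to the front and leaves
  the relation on \<open>\<psi>\<close>.\<close>

lemma U_orthogonal_word:
  assumes "g \<in> pverts G" "g' \<in> pverts G" "h \<in> pverts H" "h' \<in> pverts H"
    and "rel G g g' \<noteq> rel H h h'" and "k \<in> pverts G" "l \<in> pverts H"
  shows "U g h (U g' h' (U k l \<psi>)) = 0"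
  using U_orthogonal[OF assms(1-5)] assms(6,7) by (simp add: U_state[of k l] U_B zero)

lemma U_row_word:
  assumes "b \<in> pverts G" "g \<in> pverts G" "h \<in> pverts H"
  shows "(\<Sum>k\<in>pverts H. U b k (U g h \<psi>)) = U g h \<psi>"
  using assms by (simp add: U_state[of g h] U_B B_sum[symmetric] U_row)

section \<open>Neighbourhood sums and common neighbours\<close>

definition nbrs :: "'b \<Rightarrow> 'b set" where
  "nbrs h = {k \<in> pverts H. rel H k h = Adjacent}"

text \<open>If \<open>b\<close> and \<open>g\<close> are adjacent, the terms outside
  \<open>nbrs h\<close> vanish, so the sum is a full row; otherwise every term vanishes. Summed over
  \<open>g\<close>, this says that \<open>U\<close> intertwines the adjacency matrices on
  \<open>\<psi>\<close>.\<close>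

lemma nbrs_word:
  assumes "b \<in> pverts G" "g \<in> pverts G" "h \<in> pverts H"
  shows "(\<Sum>k\<in>nbrs h. U b k (U g h \<psi>)) = (if rel G b g = Adjacent then U g h \<psi> else 0)"
proof (cases "rel G b g = Adjacent")
  case True
  have "(\<Sum>k\<in>nbrs h. U b k (U g h \<psi>)) = (\<Sum>k\<in>pverts H. U b k (U g h \<psi>))"
    using assms True finite_pverts
    by (intro sum.mono_neutral_left) (auto simp: nbrs_def intro!: U_orthogonal)
  then show ?thesis using assms True by (simp add: U_row_word)
next
  case False
  then show ?thesis
    using assms by (auto simp: nbrs_def intro!: sum.neutral U_orthogonal)
qed

lemma nbrs_step:
  assumes b: "b \<in> pverts G" and h: "h \<in> pverts H" and S: "S \<subseteq> pverts G"
  shows "(\<Sum>k\<in>nbrs h. U b k (\<Sum>g\<in>S. U g h \<psi>)) = (\<Sum>g\<in>{g \<in> S. rel G b g = Adjacent}. U g h \<psi>)"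
proof -
  have "(\<Sum>k\<in>nbrs h. U b k (\<Sum>g\<in>S. U g h \<psi>)) = (\<Sum>g\<in>S. \<Sum>k\<in>nbrs h. U b k (U g h \<psi>))"
    unfolding U_sum by (rule sum.swap)
  also have "\<dots> = (\<Sum>g\<in>S. if rel G b g = Adjacent then U g h \<psi> else 0)"
    using b h S by (intro sum.cong refl nbrs_word) auto
  also have "\<dots> = (\<Sum>g\<in>{g \<in> S. rel G b g = Adjacent}. U g h \<psi>)"
    using finite_subset[OF S finite_pverts(1)] by (simp add: sum.inter_filter)
  finally show ?thesis .
qed

lemma common_nbrs_sum:
  assumes abc: "a \<in> pverts G" "b \<in> pverts G" "c \<in> pverts G"
  defines "C \<equiv> {g \<in> pverts G. rel G c g = Adjacent \<and> rel G b g = Adjacent \<and> rel G a g = Adjacent}"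
  shows "(\<Sum>h\<in>pverts H. \<Sum>i\<in>nbrs h. \<Sum>j\<in>nbrs h. \<Sum>k\<in>nbrs h. U a i (U b j (U c k \<psi>))) = (\<Sum>g\<in>C. \<psi>)"
proof -
  have "(\<Sum>i\<in>nbrs h. \<Sum>j\<in>nbrs h. \<Sum>k\<in>nbrs h. U a i (U b j (U c k \<psi>))) = (\<Sum>g\<in>C. U g h \<psi>)"
    if h: "h \<in> pverts H" for h
  proof -
    \<comment> \<open>The state is written as the column sum for \<open>h\<close>; then
      \<open>nbrs_step\<close>, applied from the inside outwards, filters the vertices by adjacency
      to \<open>c\<close>, \<open>b\<close> and \<open>a\<close>.\<close>
    have "(\<Sum>i\<in>nbrs h. \<Sum>j\<in>nbrs h. \<Sum>k\<in>nbrs h. U a i (U b j (U c k \<psi>)))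
        = (\<Sum>i\<in>nbrs h. U a i (\<Sum>j\<in>nbrs h. U b j (\<Sum>k\<in>nbrs h. U c k (\<Sum>g\<in>pverts G. U g h \<psi>))))"
      using h by (simp add: U_column, simp add: U_sum)
    also have "\<dots> = (\<Sum>g\<in>{g \<in> {g \<in> {g \<in> pverts G. rel G c g = Adjacent}. rel G b g = Adjacent}. rel G a g = Adjacent}. U g h \<psi>)"
      using abc h by (subst nbrs_step | blast)+
    also have "\<dots> = (\<Sum>g\<in>C. U g h \<psi>)"
      by (intro sum.cong) (auto simp: C_def)
    finally show ?thesis .
  qed
  then have "(\<Sum>h\<in>pverts H. \<Sum>i\<in>nbrs h. \<Sum>j\<in>nbrs h. \<Sum>k\<in>nbrs h. U a i (U b j (U c k \<psi>)))
      = (\<Sum>h\<in>pverts H. \<Sum>g\<in>C. U g h \<psi>)"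
    by simp
  also have "\<dots> = (\<Sum>g\<in>C. \<Sum>h\<in>pverts H. U g h \<psi>)"
    by (rule sum.swap)
  also have "\<dots> = (\<Sum>g\<in>C. \<psi>)"
    by (intro sum.cong refl U_row) (simp add: C_def)
  finally show ?thesis .
qed

text \<open>Since \<open>U a i \<psi> = B a i \<psi>\<close>, the first operator can be moved cyclically to the last place.\<close>

lemma ip_cyclic:
  assumes "a \<in> pverts G" "i \<in> pverts H"
  shows "ip \<psi> (U a i (U b j (U c k \<psi>))) = ip \<psi> (U b j (U c k (U a i \<psi>)))"
proof -
  have "ip \<psi> (U a i (U b j (U c k \<psi>))) = ip (B (Inl a) (Inr i) \<psi>) (U b j (U c k \<psi>))"
    using assms by (metis A_adjoint U_def U_state in_V)
  also have "\<dots> = ip \<psi> (U b j (U c k (B (Inl a) (Inr i) \<psi>)))"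
    using assms by (simp add: B_adjoint U_B)
  finally show ?thesis using assms by (simp add: U_state)
qed

lemma rel_Adjacent_iff:
  "rel G x y = Adjacent \<longleftrightarrow> (x, y) \<in> parcs G"
  "rel H x' y' = Adjacent \<longleftrightarrow> (x', y') \<in> parcs H"
  using pair_graph_irrefl[OF graph_G] pair_graph_irrefl[OF graph_H] by (auto simp: rel_def)

theorem K4_transfer:
  assumes "has_K4 G"
  shows "has_K4 H"
proof (rule ccontr)
  assume no_K4: "\<not> has_K4 H"
  obtain a b c e where v: "a \<in> pverts G" "b \<in> pverts G" "c \<in> pverts G" "e \<in> pverts G"
    and "(a, b) \<in> parcs G" "(a, c) \<in> parcs G" "(a, e) \<in> parcs G"
      "(b, c) \<in> parcs G" "(b, e) \<in> parcs G" "(c, e) \<in> parcs G"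
    using assms unfolding has_K4_def by blast
  \<comment> \<open>The arc between \<open>c\<close> and \<open>a\<close> is oriented from
    \<open>c\<close>, because the word rotated by \<open>ip_cyclic\<close> ends in the letters of
    \<open>c\<close> and \<open>a\<close>.\<close>
  then have adj: "rel G a b = Adjacent" "rel G c a = Adjacent" "rel G a e = Adjacent"
      "rel G b c = Adjacent" "rel G b e = Adjacent" "rel G c e = Adjacent"
    by (simp_all add: rel_Adjacent_iff pair_graph_sym[OF graph_G, of c a])
  define C where
    "C = {g \<in> pverts G. rel G c g = Adjacent \<and> rel G b g = Adjacent \<and> rel G a g = Adjacent}"
  have "e \<in> C" "finite C"
    using v adj finite_pverts by (auto simp: C_def)
  have "ip \<psi> (U a i (U b j (U c k \<psi>))) = 0"
    if h: "h \<in> pverts H" and "i \<in> nbrs h" "j \<in> nbrs h" "k \<in> nbrs h" for h i j k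
  proof -
    have ijk: "i \<in> pverts H" "j \<in> pverts H" "k \<in> pverts H"
        "(i, h) \<in> parcs H" "(j, h) \<in> parcs H" "(k, h) \<in> parcs H"
      using that by (auto simp: nbrs_def rel_Adjacent_iff)
    have "\<not> ((i, j) \<in> parcs H \<and> (j, k) \<in> parcs H \<and> (k, i) \<in> parcs H)"
      using no_K4 h ijk pair_graph_sym[OF graph_H, of k i] unfolding has_K4_def by blast
    \<comment> \<open>A missing edge kills the first two letters of the word, or the last two, or
      the last two after one rotation.\<close>
    then consider "rel G a b \<noteq> rel H i j" | "rel G b c \<noteq> rel H j k" | "rel G c a \<noteq> rel H k i"
      using adj by (metis rel_Adjacent_iff(2))
    then show ?thesis
    proof cases
      case 1
      with v ijk show ?thesis by (simp add: U_orthogonal_word zero)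
    next
      case 2
      with v ijk show ?thesis by (simp add: U_orthogonal, simp add: U_def zero)
    next
      case 3
      with v ijk show ?thesis
        unfolding ip_cyclic[OF v(1) ijk(1)] by (simp add: U_orthogonal, simp add: U_def zero)
    qed
  qed
  then have "0 = ip \<psi> (\<Sum>h\<in>pverts H. \<Sum>i\<in>nbrs h. \<Sum>j\<in>nbrs h. \<Sum>k\<in>nbrs h. U a i (U b j (U c k \<psi>)))"
    by (simp add: ip_sum)
  \<comment> \<open>The fourth vertex \<open>e\<close> of the clique lies in \<open>C\<close>, so
    this value is nonzero.\<close>
  also have "\<dots> = of_nat (card C) * ip \<psi> \<psi>"
    unfolding common_nbrs_sum[OF v(1-3)] by (simp add: ip_sum C_def)
  finally show False
    using \<open>e \<in> C\<close> \<open>finite C\<close> ip_state by auto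
qed

end

section \<open>Gram factorization of positive semidefinite matrices\<close>

text \<open>Hermitian symmetry makes the form real, so its real part loses nothing. An arbitrary
  index set permits induction on the indices.\<close>

definition hermitian_psd_on :: "'i set \<Rightarrow> ('i \<Rightarrow> 'i \<Rightarrow> complex) \<Rightarrow> bool" where
  "hermitian_psd_on I M \<longleftrightarrow>
    (\<forall>i\<in>I. \<forall>j\<in>I. M j i = cnj (M i j)) \<and>
    (\<forall>c. 0 \<le> Re (\<Sum>i\<in>I. \<Sum>j\<in>I. cnj (c i) * M i j * c j))"

text \<open>Block expansion at the new index \<open>k\<close>: the two off-diagonal blocks are
  conjugate and add up to twice a real part.\<close>

lemma hermitian_form_insert:
  assumes "finite I" "k \<notin> I" "\<And>i. i \<in> I \<Longrightarrow> M i k = cnj (M k i)"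
  shows "Re (\<Sum>i\<in>insert k I. \<Sum>j\<in>insert k I. cnj ((c(k := t)) i) * M i j * (c(k := t)) j) =
    Re (cnj t * M k k * t) + 2 * Re (cnj t * (\<Sum>j\<in>I. M k j * c j)) +
    Re (\<Sum>i\<in>I. \<Sum>j\<in>I. cnj (c i) * M i j * c j)"
proof -
  define e where "e = c(k := t)"
  have e: "e k = t" "\<And>i. i \<in> I \<Longrightarrow> e i = c i"
    using assms(2) by (auto simp: e_def)
  have 1: "(\<Sum>j\<in>insert k I. cnj t * M k j * e j) =
      cnj t * M k k * t + cnj t * (\<Sum>j\<in>I. M k j * c j)"
    using assms(1,2) by (simp add: e sum_distrib_left mult.assoc cong: sum.cong)
  have 2: "(\<Sum>i\<in>I. \<Sum>j\<in>insert k I. cnj (e i) * M i j * e j) =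
      cnj (cnj t * (\<Sum>j\<in>I. M k j * c j)) + (\<Sum>i\<in>I. \<Sum>j\<in>I. cnj (c i) * M i j * c j)"
  proof -
    have "(\<Sum>i\<in>I. \<Sum>j\<in>insert k I. cnj (e i) * M i j * e j) =
        (\<Sum>i\<in>I. t * (cnj (M k i) * cnj (c i)) + (\<Sum>j\<in>I. cnj (c i) * M i j * c j))"
      using assms by (intro sum.cong refl) (simp add: e mult_ac cong: sum.cong)
    then show ?thesis
      by (simp add: sum.distrib sum_distrib_left)
  qed
  have "(\<Sum>i\<in>insert k I. \<Sum>j\<in>insert k I. cnj (e i) * M i j * e j) =
      (\<Sum>j\<in>insert k I. cnj t * M k j * e j) + (\<Sum>i\<in>I. \<Sum>j\<in>insert k I. cnj (e i) * M i j * e j)"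
    by (subst sum.insert[OF assms(1,2)]) (simp only: e(1))
  moreover have "Re (a + cnj t * w + (cnj (cnj t * w) + q)) = Re a + 2 * Re (cnj t * w) + Re q" for a w q
    by simp
  ultimately show ?thesis
    by (simp only: 1 2 e_def[symmetric])
qed

text \<open>Cholesky factorization by induction: the new index contributes one vector, and the Schur
  complement supplies the others.\<close>

lemma hermitian_psd_on_gram:
  assumes "finite I" "hermitian_psd_on I M"
  shows "\<exists>v. \<forall>i\<in>I. \<forall>j\<in>I. M i j = (\<Sum>k\<in>I. v k i * cnj (v k j))"
  using assms
proof (induction I arbitrary: M rule: finite_induct)
  case empty
  then show ?case by simp
next
  case (insert k I)
  let ?a = "Re (M k k)"
  have herm: "M j i = cnj (M i j)" if "i \<in> insert k I" "j \<in> insert k I" for i j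
    using insert.prems that unfolding hermitian_psd_on_def by blast
  have form: "0 \<le> Re (cnj t * M k k * t) + 2 * Re (cnj t * (\<Sum>j\<in>I. M k j * c j)) +
      Re (\<Sum>i\<in>I. \<Sum>j\<in>I. cnj (c i) * M i j * c j)" for t c
  proof -
    have "M i k = cnj (M k i)" if "i \<in> I" for i
      using herm that by blast
    note eq = hermitian_form_insert[of I k M c t, OF insert.hyps this]
    have "0 \<le> Re (\<Sum>i\<in>insert k I. \<Sum>j\<in>insert k I. cnj ((c(k := t)) i) * M i j * (c(k := t)) j)"
      using insert.prems unfolding hermitian_psd_on_def by blast
    then show ?thesis
      by (simp only: eq)
  qed
  have a: "M k k = of_real ?a"
    using herm[of k k] by (simp add: complex_eq_iff)
  have a_nonneg: "0 \<le> ?a"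
    using form[of 1 "\<lambda>_. 0"] by simp
  have row_zero: "M k j = 0" if "?a = 0" "j \<in> I" for j
  proof (rule ccontr)
    assume nz: "M k j \<noteq> 0"
    \<comment> \<open>Chosen so that the form at \<open>t = - r * M k j\<close> and the unit vector
      of \<open>j\<close> equals -1, contradicting positivity.\<close>
    define r where "r = (Re (M j j) + 1) / (2 * (cmod (M k j))\<^sup>2)"
    have delta: "(\<Sum>i\<in>I. f i * of_bool (i = j)) = f j" for f :: "'a \<Rightarrow> complex"
      using that insert.hyps by (simp add: of_bool_def if_distrib cong: if_cong)
    have "(\<Sum>i\<in>I. \<Sum>l\<in>I. cnj (of_bool (i = j)) * M i l * of_bool (l = j)) =
        (\<Sum>i\<in>I. cnj (of_bool (i = j)) * M i j)"
      by (simp only: delta)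
    also have "\<dots> = (\<Sum>i\<in>I. M i j * of_bool (i = j))"
      by (intro sum.cong refl) (simp add: of_bool_def)
    also have "\<dots> = M j j"
      by (rule delta)
    finally have "(\<Sum>i\<in>I. \<Sum>l\<in>I. cnj (of_bool (i = j)) * M i l * of_bool (l = j)) = M j j" .
    then have "0 \<le> 2 * Re (cnj (- of_real r * M k j) * M k j) + Re (M j j)"
      using form[of "- of_real r * M k j" "\<lambda>i. of_bool (i = j)"] that a delta by simp
    also have "Re (cnj (- of_real r * M k j) * M k j) = - r * (cmod (M k j))\<^sup>2"
      by (simp add: cmod_power2) (simp add: power2_eq_square algebra_simps)
    finally show False
      using nz by (simp add: r_def field_simps)
  qed
  \<comment> \<open>The Schur complement of the entry \<open>(k, k)\<close>; if that entry is 0, so is its row, and division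
    by 0 leaves \<open>M\<close> unchanged.\<close>
  define S where "S i j = M i j - M i k * M k j / of_real ?a" for i j
  have "hermitian_psd_on I S"
    unfolding hermitian_psd_on_def
  proof (intro conjI ballI allI)
    fix i j assume "i \<in> I" "j \<in> I"
    then show "S j i = cnj (S i j)"
      using herm[of i j] herm[of i k] herm[of k j] by (simp add: S_def mult.commute)
  next
    fix c :: "'a \<Rightarrow> complex"
    define w where "w = (\<Sum>j\<in>I. M k j * c j)"
    have cw: "(\<Sum>i\<in>I. cnj (c i) * M i k) = cnj w"
      unfolding w_def using herm[of k] by (simp add: mult.commute cong: sum.cong)
    have "(\<Sum>i\<in>I. \<Sum>j\<in>I. cnj (c i) * S i j * c j) =
        (\<Sum>i\<in>I. \<Sum>j\<in>I. cnj (c i) * M i j * c j) -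
        (\<Sum>i\<in>I. \<Sum>j\<in>I. (cnj (c i) * M i k) * (M k j * c j)) / of_real ?a"
      by (simp add: S_def algebra_simps sum_subtractf sum_divide_distrib)
    also have "(\<Sum>i\<in>I. \<Sum>j\<in>I. (cnj (c i) * M i k) * (M k j * c j)) = cnj w * w"
      by (simp only: sum_product[symmetric] cw w_def[symmetric])
    finally have S: "Re (\<Sum>i\<in>I. \<Sum>j\<in>I. cnj (c i) * S i j * c j) =
        Re (\<Sum>i\<in>I. \<Sum>j\<in>I. cnj (c i) * M i j * c j) - (cmod w)\<^sup>2 / ?a"
      by (simp add: cmod_power2) (simp add: power2_eq_square)
    \<comment> \<open>For a nonzero pivot this value of the new coordinate minimizes the form, and
      the minimum is the form of \<open>S\<close>. For a zero pivot, division by 0 makes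
      \<open>?t\<close> and both sides below 0.\<close>
    let ?t = "- (w / of_real ?a)"
    have "Re (cnj ?t * M k k * ?t) + 2 * Re (cnj ?t * w) = - ((cmod w)\<^sup>2 / ?a)"
    proof (cases "?a = 0")
      case False
      define r where "r = ?a"
      have r: "M k k = of_real r" "r \<noteq> 0"
        using a False by (simp_all add: r_def)
      have w: "cnj w * w = of_real ((cmod w)\<^sup>2)"
        by (simp only: complex_norm_square mult.commute)
      have "cnj ?t * M k k * ?t = cnj w * w / of_real r"
        unfolding r_def[symmetric] r(1) using r(2) by simp
      moreover have "cnj ?t * w = - (cnj w * w / of_real r)"
        unfolding r_def[symmetric] by simp
      ultimately have "cnj ?t * M k k * ?t = of_real ((cmod w)\<^sup>2 / r)"
        "cnj ?t * w = of_real (- ((cmod w)\<^sup>2 / r))"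
        unfolding w by simp_all
      then show ?thesis
        by (simp only: Re_complex_of_real r_def[symmetric])
    qed simp
    then show "0 \<le> Re (\<Sum>i\<in>I. \<Sum>j\<in>I. cnj (c i) * S i j * c j)"
      using form[of ?t c] unfolding S w_def[symmetric] by linarith
  qed
  then obtain v where v: "\<And>i j. i \<in> I \<Longrightarrow> j \<in> I \<Longrightarrow> S i j = (\<Sum>l\<in>I. v l i * cnj (v l j))"
    using insert.IH by blast
  \<comment> \<open>The vector at \<open>k\<close> is the pivot column divided by the root of the
    pivot; the others are extended by 0 at \<open>k\<close>.\<close>
  define u where "u l i = (if l = k then M i k / of_real (sqrt ?a) else if i = k then 0 else v l i)" for l i
  have uk: "u k i * cnj (u k j) = M i k * M k j / of_real ?a"
    if "i \<in> insert k I" "j \<in> insert k I" for i j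
    using herm[of j k] that a_nonneg
    by (simp add: u_def of_real_mult[symmetric] del: of_real_mult)
  have row: "M i k * M k j / of_real ?a = M i j"
    if "i = k \<or> j = k" "i \<in> insert k I" "j \<in> insert k I" for i j
  proof (cases "?a = 0")
    case True
    have "M k l = 0" "M l k = 0" if "l \<in> insert k I" for l
      using True that row_zero[of l] a herm[of k l] by auto
    with that True show ?thesis by auto
  next
    case False
    with a have "M k k \<noteq> 0" by (metis of_real_eq_0_iff)
    with that show ?thesis by (subst a[symmetric]) auto
  qed
  have "M i j = (\<Sum>l\<in>insert k I. u l i * cnj (u l j))"
    if ij: "i \<in> insert k I" "j \<in> insert k I" for i j
  proof -
    have "(\<Sum>l\<in>insert k I. u l i * cnj (u l j)) =
        M i k * M k j / of_real ?a + (\<Sum>l\<in>I. u l i * cnj (u l j))"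
      using insert.hyps uk[OF ij] by simp
    also have "\<dots> = M i j"
    proof (cases "i = k \<or> j = k")
      case True
      then have "(\<Sum>l\<in>I. u l i * cnj (u l j)) = 0"
        using insert.hyps by (intro sum.neutral) (auto simp: u_def)
      with row[OF True ij] show ?thesis by simp
    next
      case False
      with ij have "i \<in> I" "j \<in> I" by auto
      have "(\<Sum>l\<in>I. u l i * cnj (u l j)) = (\<Sum>l\<in>I. v l i * cnj (v l j))"
        using insert.hyps False by (intro sum.cong) (auto simp: u_def)
      also have "\<dots> = S i j"
        using v \<open>i \<in> I\<close> \<open>j \<in> I\<close> by simp
      finally show ?thesis by (simp add: S_def)
    qed
    finally show ?thesis by simp
  qed
  then show ?case by blast
qed

text \<open>The form is the sum of the squared moduli of \<open>s l\<close>, so if it is 0 then all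
  \<open>s l\<close> vanish, and with them the image of \<open>c\<close>.\<close>

lemma gram_kernel:
  fixes r :: "'k \<Rightarrow> 'i \<Rightarrow> complex"
  assumes "finite L"
    and K: "\<And>x y. x \<in> J \<Longrightarrow> y \<in> J \<Longrightarrow> K x y = (\<Sum>l\<in>L. r l x * cnj (r l y))"
    and zero: "(\<Sum>x\<in>J. \<Sum>y\<in>J. cnj (c x) * K x y * c y) = 0"
    and x: "x \<in> J"
  shows "(\<Sum>y\<in>J. K x y * c y) = 0"
proof -
  define s where "s l = (\<Sum>y\<in>J. cnj (r l y) * c y)" for l
  have Ks: "(\<Sum>y\<in>J. K x y * c y) = (\<Sum>l\<in>L. r l x * s l)" if "x \<in> J" for x
  proof -
    have "(\<Sum>y\<in>J. K x y * c y) = (\<Sum>y\<in>J. \<Sum>l\<in>L. r l x * (cnj (r l y) * c y))"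
      using that by (intro sum.cong refl) (simp add: K sum_distrib_right mult.assoc)
    also have "\<dots> = (\<Sum>l\<in>L. \<Sum>y\<in>J. r l x * (cnj (r l y) * c y))"
      by (rule sum.swap)
    finally show ?thesis by (simp add: s_def sum_distrib_left)
  qed
  have "(\<Sum>x\<in>J. \<Sum>y\<in>J. cnj (c x) * K x y * c y) = (\<Sum>x\<in>J. cnj (c x) * (\<Sum>y\<in>J. K x y * c y))"
    by (simp add: sum_distrib_left mult.assoc)
  also have "\<dots> = (\<Sum>x\<in>J. cnj (c x) * (\<Sum>l\<in>L. r l x * s l))"
    using Ks by (intro sum.cong) simp_all
  also have "\<dots> = (\<Sum>x\<in>J. \<Sum>l\<in>L. s l * (r l x * cnj (c x)))"
    by (simp add: sum_distrib_left mult_ac)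
  also have "\<dots> = (\<Sum>l\<in>L. \<Sum>x\<in>J. s l * (r l x * cnj (c x)))"
    by (rule sum.swap)
  also have "\<dots> = (\<Sum>l\<in>L. s l * (\<Sum>x\<in>J. r l x * cnj (c x)))"
    by (simp only: sum_distrib_left)
  also have "\<dots> = (\<Sum>l\<in>L. s l * cnj (s l))"
    by (simp add: s_def)
  also have "\<dots> = of_real (\<Sum>l\<in>L. (cmod (s l))\<^sup>2)"
    by (simp only: of_real_sum complex_norm_square)
  finally have "of_real (\<Sum>l\<in>L. (cmod (s l))\<^sup>2) = (0 :: complex)"
    using zero by simp
  then have "(\<Sum>l\<in>L. (cmod (s l))\<^sup>2) = 0"
    by (simp only: of_real_eq_0_iff)
  then have "\<forall>l\<in>L. s l = 0"
    using assms(1) by (simp add: sum_nonneg_eq_0_iff)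
  with x show ?thesis by (simp add: Ks)
qed

section \<open>Quantum strategies as commuting operator strategies\<close>

lemma psd_mat_adjoint_entry:
  assumes "psd_mat d P" "i < d" "j < d"
  shows "P $$ (j, i) = cnj (P $$ (i, j))"
proof -
  have P: "P \<in> carrier_mat d d" "mat_adjoint P = P"
    using assms by (simp_all add: psd_mat_def)
  have "mat_adjoint P $$ (j, i) = cnj (P $$ (i, j))"
    using P(1) assms(2,3) by (simp add: mat_adjoint_def mat_of_rows_def conjugate_complex_def)
  with P(2) show ?thesis by simp
qed

lemma psd_mat_hermitian_psd_on:
  assumes "psd_mat d P"
  shows "hermitian_psd_on {..<d} (\<lambda>i j. P $$ (i, j))"
  unfolding hermitian_psd_on_def
proof (intro conjI ballI allI)
  show "P $$ (j, i) = cnj (P $$ (i, j))" if "i \<in> {..<d}" "j \<in> {..<d}" for i j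
    by (rule psd_mat_adjoint_entry[OF assms]) (use that in simp_all)
next
  fix c :: "nat \<Rightarrow> complex"
  have P: "P \<in> carrier_mat d d" and pos: "0 \<le> (P *\<^sub>v vec d c) \<bullet>c vec d c"
    using assms by (auto simp: psd_mat_def)
  have "(P *\<^sub>v vec d c) \<bullet>c vec d c = (\<Sum>i<d. \<Sum>j<d. cnj (c i) * P $$ (i, j) * c j)"
    using carrier_matD[OF P] by (simp add: scalar_prod_def sum_distrib_left sum_distrib_right mult_ac
        conjugate_complex_def lessThan_atLeast0 cong: sum.cong_simp)
  with pos show "0 \<le> Re (\<Sum>i<d. \<Sum>j<d. cnj (c i) * P $$ (i, j) * c j)"
    by (simp add: less_eq_complex_def)
qed

text \<open>Tensors are functions on index pairs, a type with a group structure of its own. The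
  default 0 outside the square makes identities of tensors hold as equations of functions.\<close>

definition act_left :: "nat \<Rightarrow> complex mat \<Rightarrow> (nat \<times> nat \<Rightarrow> complex) \<Rightarrow> nat \<times> nat \<Rightarrow> complex" where
  "act_left d P \<phi> = (\<lambda>(i, j). if i < d \<and> j < d then \<Sum>k<d. P $$ (i, k) * \<phi> (k, j) else 0)"

definition act_right :: "nat \<Rightarrow> complex mat \<Rightarrow> (nat \<times> nat \<Rightarrow> complex) \<Rightarrow> nat \<times> nat \<Rightarrow> complex" where
  "act_right d Q \<phi> = (\<lambda>(i, j). if i < d \<and> j < d then \<Sum>k<d. Q $$ (j, k) * \<phi> (i, k) else 0)"

text \<open>The left argument is conjugated, whereas \<open>\<bullet>c\<close> conjugates the right
  one; hence the swapped order in \<open>kronecker_form\<close>.\<close>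

definition inner_on :: "nat \<Rightarrow> (nat \<times> nat \<Rightarrow> complex) \<Rightarrow> (nat \<times> nat \<Rightarrow> complex) \<Rightarrow> complex" where
  "inner_on d \<phi> \<chi> = (\<Sum>i<d. \<Sum>j<d. cnj (\<phi> (i, j)) * \<chi> (i, j))"

definition tensor_of_vec :: "nat \<Rightarrow> complex vec \<Rightarrow> nat \<times> nat \<Rightarrow> complex" where
  "tensor_of_vec d \<psi> = (\<lambda>(i, j). if i < d \<and> j < d then \<psi> $ (i * d + j) else 0)"

section \<open>Additivity, commutation and self-adjointness of the two actions\<close>

lemma act_left_add: "act_left d P (\<phi> + \<chi>) = act_left d P \<phi> + act_left d P \<chi>"
  by (auto simp: act_left_def fun_eq_iff sum.distrib algebra_simps)

lemma act_right_add: "act_right d Q (\<phi> + \<chi>) = act_right d Q \<phi> + act_right d Q \<chi>"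
  by (auto simp: act_right_def fun_eq_iff sum.distrib algebra_simps)

lemma inner_on_add: "inner_on d \<phi> (\<chi> + \<xi>) = inner_on d \<phi> \<chi> + inner_on d \<phi> \<xi>"
  by (simp add: inner_on_def sum.distrib algebra_simps)

lemma act_left_right_apply:
  assumes "i < d" "j < d"
  shows "act_left d P (act_right d Q \<phi>) (i, j) =
    (\<Sum>k<d. \<Sum>l<d. (P $$ (i, k) * Q $$ (j, l)) * \<phi> (k, l))"
  using assms by (simp add: act_left_def act_right_def sum_distrib_left mult.assoc)

lemma act_commute: "act_left d P (act_right d Q \<phi>) = act_right d Q (act_left d P \<phi>)"
proof
  fix x :: "nat \<times> nat"
  obtain i j where x: "x = (i, j)" by fastforce
  have "(\<Sum>k<d. P $$ (i, k) * (\<Sum>l<d. Q $$ (j, l) * \<phi> (k, l))) =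
      (\<Sum>k<d. \<Sum>l<d. Q $$ (j, l) * (P $$ (i, k) * \<phi> (k, l)))"
    by (simp add: sum_distrib_left mult_ac)
  also have "\<dots> = (\<Sum>l<d. \<Sum>k<d. Q $$ (j, l) * (P $$ (i, k) * \<phi> (k, l)))"
    by (rule sum.swap)
  finally show "act_left d P (act_right d Q \<phi>) x = act_right d Q (act_left d P \<phi>) x"
    by (simp add: x act_left_def act_right_def sum_distrib_left)
qed

lemma act_left_adjoint:
  assumes "psd_mat d P"
  shows "inner_on d (act_left d P \<phi>) \<chi> = inner_on d \<phi> (act_left d P \<chi>)"
proof -
  have "inner_on d (act_left d P \<phi>) \<chi> =
      (\<Sum>i<d. \<Sum>j<d. \<Sum>k<d. cnj (P $$ (i, k)) * cnj (\<phi> (k, j)) * \<chi> (i, j))"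
    by (simp add: inner_on_def act_left_def sum_distrib_right)
  also have "\<dots> = (\<Sum>j<d. \<Sum>i<d. \<Sum>k<d. cnj (P $$ (i, k)) * cnj (\<phi> (k, j)) * \<chi> (i, j))"
    by (rule sum.swap)
  also have "\<dots> = (\<Sum>j<d. \<Sum>k<d. \<Sum>i<d. cnj (P $$ (i, k)) * cnj (\<phi> (k, j)) * \<chi> (i, j))"
    by (intro sum.cong refl sum.swap)
  also have "\<dots> = (\<Sum>k<d. \<Sum>j<d. \<Sum>i<d. cnj (P $$ (i, k)) * cnj (\<phi> (k, j)) * \<chi> (i, j))"
    by (rule sum.swap)
  also have "\<dots> = (\<Sum>k<d. \<Sum>j<d. \<Sum>i<d. cnj (\<phi> (k, j)) * (P $$ (k, i) * \<chi> (i, j)))"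
    by (intro sum.cong refl) (simp add: psd_mat_adjoint_entry[OF assms, symmetric])
  also have "\<dots> = inner_on d \<phi> (act_left d P \<chi>)"
    by (simp add: inner_on_def act_left_def sum_distrib_left)
  finally show ?thesis .
qed

lemma act_right_adjoint:
  assumes "psd_mat d Q"
  shows "inner_on d (act_right d Q \<phi>) \<chi> = inner_on d \<phi> (act_right d Q \<chi>)"
proof -
  have "inner_on d (act_right d Q \<phi>) \<chi> =
      (\<Sum>i<d. \<Sum>j<d. \<Sum>k<d. cnj (Q $$ (j, k)) * cnj (\<phi> (i, k)) * \<chi> (i, j))"
    by (simp add: inner_on_def act_right_def sum_distrib_right)
  also have "\<dots> = (\<Sum>i<d. \<Sum>k<d. \<Sum>j<d. cnj (Q $$ (j, k)) * cnj (\<phi> (i, k)) * \<chi> (i, j))"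
    by (intro sum.cong refl sum.swap)
  also have "\<dots> = (\<Sum>i<d. \<Sum>k<d. \<Sum>j<d. cnj (\<phi> (i, k)) * (Q $$ (k, j) * \<chi> (i, j)))"
    by (intro sum.cong refl) (simp add: psd_mat_adjoint_entry[OF assms, symmetric])
  also have "\<dots> = inner_on d \<phi> (act_right d Q \<chi>)"
    by (simp add: inner_on_def act_right_def sum_distrib_left)
  finally show ?thesis .
qed

lemma sum_fun_apply: "(\<Sum>s\<in>S. f s) x = (\<Sum>s\<in>S. f s x)"
  by (induction S rule: infinite_finite_induct) simp_all

lemma act_total:
  assumes "mat d d (\<lambda>ij. \<Sum>y\<in>V. P y $$ ij) = 1\<^sub>m d"
  shows "(\<Sum>y\<in>V. act_left d (P y) (tensor_of_vec d \<psi>)) = tensor_of_vec d \<psi>"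
    and "(\<Sum>y\<in>V. act_right d (P y) (tensor_of_vec d \<psi>)) = tensor_of_vec d \<psi>"
proof -
  have entry: "(\<Sum>y\<in>V. P y $$ (i, k)) = of_bool (i = k)" if "i < d" "k < d" for i k
    using arg_cong[OF assms, of "\<lambda>M. M $$ (i, k)"] that by simp
  have row: "(\<Sum>y\<in>V. \<Sum>k<d. P y $$ (i, k) * f k) = f i" if "i < d" for i f
  proof -
    have "(\<Sum>y\<in>V. \<Sum>k<d. P y $$ (i, k) * f k) = (\<Sum>k<d. (\<Sum>y\<in>V. P y $$ (i, k)) * f k)"
      by (subst sum.swap) (simp add: sum_distrib_right)
    also have "\<dots> = (\<Sum>k<d. if k = i then f k else 0)"
      using that by (intro sum.cong) (auto simp: entry)
    also have "\<dots> = f i"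
      using that by simp
    finally show ?thesis .
  qed
  have "(\<Sum>y\<in>V. act_left d (P y) (tensor_of_vec d \<psi>)) (i, j) = tensor_of_vec d \<psi> (i, j)" for i j
    using row[of i "\<lambda>k. tensor_of_vec d \<psi> (k, j)"]
    by (cases "i < d \<and> j < d") (auto simp: sum_fun_apply act_left_def tensor_of_vec_def)
  then show "(\<Sum>y\<in>V. act_left d (P y) (tensor_of_vec d \<psi>)) = tensor_of_vec d \<psi>"
    by auto
  have "(\<Sum>y\<in>V. act_right d (P y) (tensor_of_vec d \<psi>)) (i, j) = tensor_of_vec d \<psi> (i, j)" for i j
    using row[of j "\<lambda>k. tensor_of_vec d \<psi> (i, k)"]
    by (cases "i < d \<and> j < d") (auto simp: sum_fun_apply act_right_def tensor_of_vec_def)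
  then show "(\<Sum>y\<in>V. act_right d (P y) (tensor_of_vec d \<psi>)) = tensor_of_vec d \<psi>"
    by auto
qed

text \<open>The flat index range splits into \<open>d\<close> blocks of length \<open>d\<close>,
  matching the index convention of \<open>kronecker\<close>.\<close>

lemma sum_divmod:
  fixes f :: "nat \<Rightarrow> nat \<Rightarrow> complex"
  shows "(\<Sum>m<d * d. f (m div d) (m mod d)) = (\<Sum>i<d. \<Sum>j<d. f i j)"
proof -
  have "(\<Sum>m<d * d. f (m div d) (m mod d)) = (\<Sum>i<d. \<Sum>m\<in>{i * d..<i * d + d}. f (m div d) (m mod d))"
    by (rule sum.nat_group[symmetric])
  also have "\<dots> = (\<Sum>i<d. \<Sum>j<d. f i j)"
  proof (rule sum.cong[OF refl])
    fix i
    have "(\<Sum>m\<in>{0 + i * d..<d + i * d}. f (m div d) (m mod d)) =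
        (\<Sum>j\<in>{0..<d}. f ((j + i * d) div d) ((j + i * d) mod d))"
      by (rule sum.shift_bounds_nat_ivl)
    also have "\<dots> = (\<Sum>j<d. f i j)"
      by (intro sum.cong) auto
    finally show "(\<Sum>m\<in>{i * d..<i * d + d}. f (m div d) (m mod d)) = (\<Sum>j<d. f i j)"
      by (simp add: add.commute)
  qed
  finally show ?thesis .
qed

lemma inner_on_tensor_of_vec:
  assumes "\<psi> \<in> carrier_vec (d * d)"
  shows "inner_on d (tensor_of_vec d \<psi>) (tensor_of_vec d \<psi>) = \<psi> \<bullet>c \<psi>"
proof -
  have "\<psi> \<bullet>c \<psi> = (\<Sum>m<d * d. cnj (\<psi> $ m) * \<psi> $ m)"
    using carrier_vecD[OF assms]
    by (simp add: scalar_prod_def lessThan_atLeast0 conjugate_complex_def mult.commute)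
  also have "\<dots> = (\<Sum>i<d. \<Sum>j<d. cnj (\<psi> $ (i * d + j)) * \<psi> $ (i * d + j))"
    using sum_divmod[where d = d and f = "\<lambda>i j. cnj (\<psi> $ (i * d + j)) * \<psi> $ (i * d + j)"] by simp
  also have "\<dots> = inner_on d (tensor_of_vec d \<psi>) (tensor_of_vec d \<psi>)"
    by (simp add: inner_on_def tensor_of_vec_def)
  finally show ?thesis by simp
qed

lemma kronecker_form:
  assumes P: "P \<in> carrier_mat d d" and Q: "Q \<in> carrier_mat d d" and \<psi>: "\<psi> \<in> carrier_vec (d * d)"
  shows "(kronecker P Q *\<^sub>v \<psi>) \<bullet>c \<psi> =
    inner_on d (tensor_of_vec d \<psi>) (act_left d P (act_right d Q (tensor_of_vec d \<psi>)))"
proof -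
  note dims = carrier_matD[OF P] carrier_matD[OF Q] carrier_vecD[OF \<psi>]
  define f where "f i j = (\<Sum>k<d. \<Sum>l<d. P $$ (i, k) * Q $$ (j, l) * \<psi> $ (k * d + l))" for i j
  have "(kronecker P Q *\<^sub>v \<psi>) $ m = f (m div d) (m mod d)" if "m < d * d" for m
  proof -
    have "(kronecker P Q *\<^sub>v \<psi>) $ m =
        (\<Sum>n<d * d. P $$ (m div d, n div d) * Q $$ (m mod d, n mod d) * \<psi> $ n)"
      using that by (simp add: kronecker_def dims scalar_prod_def lessThan_atLeast0)
    also have "\<dots> = f (m div d) (m mod d)"
      using sum_divmod[where d = d and f = "\<lambda>k l. P $$ (m div d, k) * Q $$ (m mod d, l) * \<psi> $ (k * d + l)"]
      by (simp add: f_def)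
    finally show ?thesis .
  qed
  then have "(kronecker P Q *\<^sub>v \<psi>) \<bullet>c \<psi> = (\<Sum>m<d * d. f (m div d) (m mod d) * cnj (\<psi> $ m))"
    by (simp add: scalar_prod_def dims lessThan_atLeast0[symmetric] conjugate_complex_def
        del: index_mult_mat_vec)
  also have "\<dots> = (\<Sum>i<d. \<Sum>j<d. f i j * cnj (\<psi> $ (i * d + j)))"
    using sum_divmod[where d = d and f = "\<lambda>i j. f i j * cnj (\<psi> $ (i * d + j))"] by simp
  also have "\<dots> = inner_on d (tensor_of_vec d \<psi>) (act_left d P (act_right d Q (tensor_of_vec d \<psi>)))"
    by (simp add: inner_on_def act_left_right_apply) (simp add: f_def tensor_of_vec_def mult.commute)
  finally show ?thesis .
qed

text \<open>Products of Gram vectors of \<open>P\<close> and \<open>Q\<close> are Gram vectors of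
  the tensor product, so \<open>gram_kernel\<close> upgrades a zero expectation to a zero
  vector.\<close>

lemma kronecker_zero:
  assumes P: "psd_mat d P" and Q: "psd_mat d Q"
    and zero: "inner_on d \<phi> (act_left d P (act_right d Q \<phi>)) = 0"
  shows "act_left d P (act_right d Q \<phi>) = 0"
proof -
  let ?J = "{..<d} \<times> {..<d}"
  let ?K = "\<lambda>x y. P $$ (fst x, fst y) * Q $$ (snd x, snd y)"
  obtain p where p: "\<forall>i\<in>{..<d}. \<forall>j\<in>{..<d}. P $$ (i, j) = (\<Sum>k\<in>{..<d}. p k i * cnj (p k j))"
    using hermitian_psd_on_gram[OF _ psd_mat_hermitian_psd_on[OF P]] by blast
  obtain q where q: "\<forall>i\<in>{..<d}. \<forall>j\<in>{..<d}. Q $$ (i, j) = (\<Sum>k\<in>{..<d}. q k i * cnj (q k j))"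
    using hermitian_psd_on_gram[OF _ psd_mat_hermitian_psd_on[OF Q]] by blast
  let ?r = "\<lambda>l x. p (fst l) (fst x) * q (snd l) (snd x)"
  have K: "?K x y = (\<Sum>l\<in>?J. ?r l x * cnj (?r l y))" if "x \<in> ?J" "y \<in> ?J" for x y
  proof -
    have "(\<Sum>l\<in>?J. ?r l x * cnj (?r l y)) =
        (\<Sum>(k, l)\<in>?J. (p k (fst x) * cnj (p k (fst y))) * (q l (snd x) * cnj (q l (snd y))))"
      by (intro sum.cong) auto
    also have "\<dots> = ?K x y"
      using that p q by (simp only: sum.cartesian_product[symmetric] sum_product[symmetric]) auto
    finally show ?thesis by simp
  qed
  have act: "act_left d P (act_right d Q \<phi>) x = (\<Sum>y\<in>?J. ?K x y * \<phi> y)" if "x \<in> ?J" for x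
    using that act_left_right_apply[of "fst x" d "snd x" P Q \<phi>]
    by (auto simp: sum.cartesian_product case_prod_unfold)
  have "(\<Sum>x\<in>?J. \<Sum>y\<in>?J. cnj (\<phi> x) * ?K x y * \<phi> y) =
      (\<Sum>x\<in>?J. cnj (\<phi> x) * act_left d P (act_right d Q \<phi>) x)"
    by (intro sum.cong refl) (simp only: act sum_distrib_left mult.assoc)
  also have "\<dots> = inner_on d \<phi> (act_left d P (act_right d Q \<phi>))"
    by (simp add: inner_on_def sum.cartesian_product case_prod_unfold)
  finally have "(\<Sum>x\<in>?J. \<Sum>y\<in>?J. cnj (\<phi> x) * ?K x y * \<phi> y) = 0"
    using zero by simp
  from gram_kernel[OF _ K this] have "act_left d P (act_right d Q \<phi>) x = 0" if "x \<in> ?J" for x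
    unfolding act[OF that] using that by blast
  moreover have "act_left d P (act_right d Q \<phi>) x = 0" if "x \<notin> ?J" for x
    using that by (auto simp: act_left_def split: prod.split)
  ultimately show ?thesis by (metis ext zero_fun_apply)
qed

theorem quantum_isomorphic_K4:
  fixes G :: "'a pair_pre_digraph" and H :: "'b pair_pre_digraph"
  assumes "pair_graph G" "pair_graph H" "quantum_isomorphic G H" "has_K4 G"
  shows "has_K4 H"
proof -
  obtain d \<psi> P Q where strategy: "quantum_strategy d (game_verts G H) \<psi> P Q"
    and perfect: "\<And>xA xB yA yB. \<lbrakk>xA \<in> game_verts G H; xB \<in> game_verts G H; yA \<in> game_verts G H;
      yB \<in> game_verts G H; \<not> wins G H xA xB yA yB\<rbrakk> \<Longrightarrow> correlation \<psi> P Q yA yB xA xB = 0"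
    using assms(3) unfolding quantum_isomorphic_def by blast
  have \<psi>: "\<psi> \<in> carrier_vec (d * d)" "\<psi> \<bullet>c \<psi> = 1"
    using strategy by (auto simp: quantum_strategy_def)
  have psd: "psd_mat d (P x y)" "psd_mat d (Q x y)"
    if "x \<in> game_verts G H" "y \<in> game_verts G H" for x y
    using strategy that by (auto simp: quantum_strategy_def measurements_def)
  have total: "mat d d (\<lambda>ij. \<Sum>y\<in>game_verts G H. P x y $$ ij) = 1\<^sub>m d"
    "mat d d (\<lambda>ij. \<Sum>y\<in>game_verts G H. Q x y $$ ij) = 1\<^sub>m d" if "x \<in> game_verts G H" for x
    using strategy that by (auto simp: quantum_strategy_def measurements_def)
  \<comment> \<open>Alice acts on the left tensor factor and Bob on the right one.\<close>
  interpret perfect_commuting_strategy G H "\<lambda>x y. act_left d (P x y)" "\<lambda>x y. act_right d (Q x y)"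
    "inner_on d" "tensor_of_vec d \<psi>"
  proof (rule perfect_commuting_strategy.intro)
    show "inner_on d (tensor_of_vec d \<psi>) (tensor_of_vec d \<psi>) \<noteq> 0"
      using inner_on_tensor_of_vec \<psi> by simp
    show "act_left d (P x y) (act_right d (Q x' y') (tensor_of_vec d \<psi>)) = 0"
      if "x \<in> game_verts G H" "x' \<in> game_verts G H" "y \<in> game_verts G H" "y' \<in> game_verts G H"
        "\<not> wins G H x x' y y'" for x x' y y'
    proof (rule kronecker_zero)
      show P: "psd_mat d (P x y)" and Q: "psd_mat d (Q x' y')"
        using psd that by auto
      then have "P x y \<in> carrier_mat d d" "Q x' y' \<in> carrier_mat d d"
        by (auto simp: psd_mat_def)
      from kronecker_form[OF this \<psi>(1)] perfect[OF that(1,2,3,4,5)]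
      show "inner_on d (tensor_of_vec d \<psi>)
          (act_left d (P x y) (act_right d (Q x' y') (tensor_of_vec d \<psi>))) = 0"
        by (simp add: correlation_def)
    qed
  qed (use assms psd total in \<open>simp_all add: act_left_add act_right_add act_commute inner_on_add
      act_left_adjoint act_right_adjoint act_total\<close>)
  show ?thesis by (rule K4_transfer[OF assms(4)])
qed

section \<open>The rook graph and the Shrikhande graph\<close>

text \<open>The number \<open>4 a + b\<close> stands for the vertex \<open>(a, b)\<close> of \<open>\<int>\<^sub>4 \<times> \<int>\<^sub>4\<close>; in the Shrikhande graph
  adjacency means that the difference is one of \<open>\<plusminus>(0, 1)\<close>, \<open>\<plusminus>(1, 0)\<close>, \<open>\<plusminus>(1, 1)\<close>.\<close>

definition graph16 :: "(nat \<Rightarrow> nat \<Rightarrow> bool) \<Rightarrow> nat pair_pre_digraph" where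
  "graph16 R = \<lparr>pverts = {..<16}, parcs = {(x, y). x < 16 \<and> y < 16 \<and> R x y}\<rparr>"

definition rook :: "nat \<Rightarrow> nat \<Rightarrow> bool" where
  "rook x y \<longleftrightarrow> x \<noteq> y \<and> (x div 4 = y div 4 \<or> x mod 4 = y mod 4)"

definition shrikhande :: "nat \<Rightarrow> nat \<Rightarrow> bool" where
  "shrikhande x y \<longleftrightarrow>
    ((x div 4 + 4 - y div 4) mod 4, (x mod 4 + 4 - y mod 4) mod 4)
      \<in> {(0, 1), (0, 3), (1, 0), (3, 0), (1, 1), (3, 3)}"

text \<open>The neighbour list of \<open>x\<close> is a parameter so that it is evaluated only once.\<close>

definition srg16_row :: "(nat \<Rightarrow> nat \<Rightarrow> bool) \<Rightarrow> nat \<Rightarrow> nat list \<Rightarrow> bool" where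
  "srg16_row R x N \<longleftrightarrow> \<not> R x x \<and> list_all (\<lambda>y. R y x) N \<and>
    list_all (\<lambda>y. length (filter (R y) N) = (if x = y then 6 else 2)) [0..<16]"

definition edgeless_among :: "(nat \<Rightarrow> nat \<Rightarrow> bool) \<Rightarrow> nat list \<Rightarrow> bool" where
  "edgeless_among R N \<longleftrightarrow> list_all (\<lambda>y. filter (R y) N = []) N"

definition triangle_free_among :: "(nat \<Rightarrow> nat \<Rightarrow> bool) \<Rightarrow> nat list \<Rightarrow> bool" where
  "triangle_free_among R N \<longleftrightarrow> list_all (\<lambda>y. edgeless_among R (filter (R y) N)) N"

section \<open>Finite checks by evaluation\<close>

lemma rook_rows: "list_all (\<lambda>x. srg16_row rook x (filter (rook x) [0..<16])) [0..<16]"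
  by code_simp

lemma shrikhande_rows: "list_all (\<lambda>x. srg16_row shrikhande x (filter (shrikhande x) [0..<16])) [0..<16]"
  by code_simp

text \<open>A four-clique through \<open>x\<close> would be a triangle among the neighbours of
  \<open>x\<close>.\<close>

lemma shrikhande_nbrs_triangle_free:
  "list_all (\<lambda>x. triangle_free_among shrikhande (filter (shrikhande x) [0..<16])) [0..<16]"
  by code_simp

lemma srg16_graph16:
  assumes "list_all (\<lambda>x. srg16_row R x (filter (R x) [0..<16])) [0..<16]"
  shows "srg16 (graph16 R)"
proof -
  have irrefl: "\<not> R x x" if "x < 16" for x
    using assms that by (auto simp: list_all_iff srg16_row_def)
  have sym: "R y x" if "x < 16" "y < 16" "R x y" for x y
    using assms that by (auto simp: list_all_iff srg16_row_def)
  have count: "length (filter (\<lambda>z. R x z \<and> R y z) [0..<16]) = (if x = y then 6 else 2)"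
    if "x < 16" "y < 16" for x y
    using assms that by (auto simp: list_all_iff srg16_row_def)
  have "finite (parcs (graph16 R))"
    by (rule finite_subset[of _ "{..<16} \<times> {..<16}"]) (auto simp: graph16_def)
  then have "pair_graph (graph16 R)"
    by unfold_locales (auto simp: graph16_def symmetric_def sym_def irrefl sym)
  moreover have "card (pverts (graph16 R)) = 16"
    by (simp add: graph16_def)
  moreover have "(\<Sum>z\<in>pverts (graph16 R). adj (graph16 R) x z * adj (graph16 R) z y) = (if x = y then 6 else 2)"
    if "x \<in> pverts (graph16 R)" "y \<in> pverts (graph16 R)" for x y
  proof -
    have xy: "x < 16" "y < 16"
      using that by (auto simp: graph16_def)
    \<comment> \<open>By symmetry of \<open>R\<close> the product is the indicator of a common
      neighbour.\<close>
    have "(\<Sum>z\<in>pverts (graph16 R). adj (graph16 R) x z * adj (graph16 R) z y) =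
        (\<Sum>z<16. of_bool (R x z \<and> R y z))"
      using xy sym by (intro sum.cong) (auto simp: graph16_def adj_def)
    also have "\<dots> = real (card {z. z < 16 \<and> R x z \<and> R y z})"
      by (simp add: lessThan_def Collect_conj_eq)
    also have "{z. z < 16 \<and> R x z \<and> R y z} = set (filter (\<lambda>z. R x z \<and> R y z) [0..<16])"
      by auto
    also have "card \<dots> = length (filter (\<lambda>z. R x z \<and> R y z) [0..<16])"
      by (intro distinct_card distinct_filter) simp
    finally show ?thesis
      using count[OF xy] by simp
  qed
  ultimately show ?thesis
    by (simp add: srg16_def)
qed

lemma has_K4_rook: "has_K4 (graph16 rook)"
proof -
  \<comment> \<open>The vertices 0 to 3 form one row of the board.\<close>
  have "rook 0 1" "rook 0 2" "rook 0 3" "rook 1 2" "rook 1 3" "rook 2 3"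
    by (simp_all add: rook_def)
  then show ?thesis
    unfolding has_K4_def
    by (intro bexI[of _ 0] bexI[of _ 1] bexI[of _ 2] bexI[of _ 3]) (simp_all add: graph16_def)
qed

lemma not_has_K4_shrikhande: "\<not> has_K4 (graph16 shrikhande)"
proof
  assume "has_K4 (graph16 shrikhande)"
  then obtain a b c e where *: "a < 16" "b < 16" "c < 16" "e < 16"
      "shrikhande a b" "shrikhande a c" "shrikhande a e"
      "shrikhande b c" "shrikhande b e" "shrikhande c e"
    unfolding has_K4_def by (auto simp: graph16_def)
  let ?N = "filter (shrikhande a) [0..<16]"
  have "triangle_free_among shrikhande ?N"
    using bspec[OF shrikhande_nbrs_triangle_free[unfolded list_all_iff], of a] *(1) by simp
  moreover have "b \<in> set ?N"
    using * by simp
  ultimately have "edgeless_among shrikhande (filter (shrikhande b) ?N)"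
    unfolding triangle_free_among_def list_all_iff by blast
  moreover have "c \<in> set (filter (shrikhande b) ?N)"
    using * by simp
  ultimately have "filter (shrikhande c) (filter (shrikhande b) ?N) = []"
    unfolding edgeless_among_def list_all_iff by blast
  moreover have "e \<in> set (filter (shrikhande c) (filter (shrikhande b) ?N))"
    using * by simp
  ultimately show False by simp
qed

theorem theorem7p2:
  shows "\<exists>(G :: nat pair_pre_digraph) (H :: nat pair_pre_digraph).
    pair_graph G \<and> pair_graph H \<and> dnn_isomorphic G H \<and> \<not> quantum_isomorphic G H"
proof (intro exI conjI)
  have rook: "srg16 (graph16 rook)" and shrikhande: "srg16 (graph16 shrikhande)"
    by (rule srg16_graph16 rook_rows shrikhande_rows)+
  then show graphs: "pair_graph (graph16 rook)" "pair_graph (graph16 shrikhande)"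
    by (simp_all add: srg16_def)
  show "dnn_isomorphic (graph16 rook) (graph16 shrikhande)"
    by (rule srg16_dnn_isomorphic[OF rook shrikhande])
  show "\<not> quantum_isomorphic (graph16 rook) (graph16 shrikhande)"
    using quantum_isomorphic_K4[OF graphs _ has_K4_rook] not_has_K4_shrikhande by blast
qed

end
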